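(* In the setting described in the context, let $f^*$ be the density of the stopping time $\tau(\mu^* )$ of the greedy exploration process, let $T(r)=g(r)/G(r)$ be the time cap and $\chi T(r)$ the service quota in the service-quota menu, where $g/G$ is weakly decreasing on $(\underline r,\overline r]$ (and $T(\underline r)=+\infty$), and let $$P(r)=\int_0^{T(r)}e^{-rt}f^*(t)\,dt-\int_r^{\overline r}\int_0^{T(z)}e^{-zt}\,t\,f^*(t)\,dt\,dz$$ be the associated transfer. Then the marginal price per additional unit of cap is $$\frac{P'(r)}{T'(r)}=e^{-rT(r)}f^*(T(r)).$$ The marginal price is decreasing in the cap $\chi T(r)$ whenever (a) the greedy stopping density $f^*$ is weakly decreasing and (b) $r\,T(r)$ is weakly decreasing in $r$. Moreover, condition (a) holds automatically: along the greedy path (absent a breakthrough) $\zeta(t)=\min_\theta D(e_\theta\mid\widehat\mu_t)$ is non-decreasing in $t$, so the breakthrough hazard $\chi/\zeta(t)$ is non-increasing and $f^*$ is weakly decreasing.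
   Context: **States and beliefs.** $\Theta=\{1,\dots,n\}$; $\Delta(\Theta)$ is the probability simplex in $\mathbb R^n$; $e_\theta$ is the $\theta$-th unit vector (the degenerate belief at $\theta$). The prior is $\mu_0\in\Delta(\Theta)$; $\chi>0$ is a constant (throughput rate). For a $\Delta(\Theta)$-valued process $\langle\mu_t\rangle_{t\ge0}$, $\tau(\mu)=\inf\{t\ge0:\mu_t\in\{e_1,\dots,e_n\}\}$. **Types.** The customer's private type is the discount rate $r\in[\underline r,\overline r]$, $0<\underline r<\overline r$, with CDF $G$ and density $g$. In the service-quota menu, a customer reporting $r$ pays $P(r)$ for access to the greedy exploration process up to time $T(r)$. **Entropy.** $H:\Delta(\Theta)\to\mathbb R$ is strictly convex and $C^2$ smooth. It is extended from $\Delta(\Theta)$ to the nonnegative orthant homogeneously of degree one, with $H(0)=0$; $\nabla H$ and $\mathrm{Hess}\,H$ are the gradient and Hessian of this extension. $H$ is *irreducible*: at every interior $\mu$, the graph on $\Theta$ with an edge between $\theta\ne\theta'$ whenever $\mathrm{Hess}\,H(\mu)_{\theta\theta'}\neq0$ is connected. The Bregman divergence is $D(\mu'\mid\mu)=H(\mu')-H(\mu)-\nabla H(\mu)\cdot(\mu'-\mu)$. **Assumptions on $D$.** (i) $\sup_{\mu\in\Delta(\Theta)}\min_{\theta\in\Theta}D(e_\theta\mid\mu)<\infty$. (ii) There exists $\epsilon>0$ such that for all $\mu\in\Delta(\Theta)$ and $\theta$ with $\mu(\theta)\le\epsilon$, $D(e_\theta\mid\mu)>\min_{\theta'\neq\theta}D(e_{\theta'}\mid\mu)$.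 (iii) For all interior $\mu$ and all $\theta\ne\theta'$, $(e_\theta-\mu)^\top\nabla_\mu D(e_{\theta'}\mid\mu)\ge0$. **Greedy exploration process $\langle\mu^*_t\rangle$.** Defined recursively. Start with $k=1$, $\widehat\mu^1=\mu_0$, $\widehat t^1=0$, $\Theta^1=\arg\min_{\theta\in\Theta}D(e_\theta\mid\widehat\mu^1)$. - While $\Theta^k\subsetneq\Theta$: for $t\ge\widehat t^k$, Poisson rates $(\beta_t(\theta))_{\theta\in\Theta^k}$ and a path $\widehat\mu_t$ with $\widehat\mu_{\widehat t^k}=\widehat\mu^k$ are defined by $D(e_\theta\mid\widehat\mu_t)=D(e_{\theta'}\mid\widehat\mu_t)$ for all $\theta,\theta'\in\Theta^k$; $\ \sum_{\theta\in\Theta^k}\beta_t(\theta)D(e_\theta\mid\widehat\mu_t)=\chi$; $\ \frac{d\widehat\mu_t}{dt}=-\sum_{\theta\in\Theta^k}\beta_t(\theta)(e_\theta-\widehat\mu_t)$. Let $\widehat t^{k+1}$ be the earliest time at which a new state enters $\arg\min_\theta D(e_\theta\mid\widehat\mu_t)$; set $\widehat\mu^{k+1}=\widehat\mu_{\widehat t^{k+1}}$, $\Theta^{k+1}=\arg\min_\theta D(e_\theta\mid\widehat\mu^{k+1})$, and increase $k$ by one. - Once $\Theta^k=\Theta$: set $\widehat\mu_t\equiv\widehat\mu^k$ for $t\ge\widehat t^k$ and $\beta_t(\theta)\equiv\frac{\chi}{\zeta}\widehat\mu^k(\theta)$, where $\zeta=D(e_\theta\mid\widehat\mu^k)$ is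 the common value over $\theta$ (and $\widehat t^{k+1}=\infty$). For $t\in[\widehat t^k,\widehat t^{k+1})$, the belief evolves as the compensated Poisson process $d\mu^*_t=\sum_{\theta\in\Theta^k}(dQ^\theta_t(\beta_t(\theta))-\beta_t(\theta)\,dt)(e_\theta-\mu^*_t)$, where $Q^\theta_t(x)$ are independent Poisson counters with arrival rate $x$. That is, before the first arrival (breakthrough) $\mu^*_t=\widehat\mu_t$; at the first arrival, say of counter $\theta$, the belief jumps to $e_\theta$ and the process ends. The hazard rate of $\tau(\mu^* )$ at time $t$ is $\sum_{\theta\in\Theta^k}\beta_t(\theta)=\chi/\zeta(t)$. *)

theory Defs
  imports "HOL-Probability.Probability"
begin

section \<open>Beliefs and entropy\<close>

text \<open>The state space \<open>{1,\<dots>,n}\<close> is a finite index type \<open>'n\<close>.\<close>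

definition belief_simplex :: "(real ^ 'n) set" where
  "belief_simplex = {\<mu>. (\<forall>i. 0 \<le> \<mu> $ i) \<and> (\<Sum>i\<in>UNIV. \<mu> $ i) = 1}"

definition interior_simplex :: "(real ^ 'n) set" where
  "interior_simplex = {\<mu>\<in>belief_simplex. \<forall>i. 0 < \<mu> $ i}"

definition open_face :: "'n set \<Rightarrow> (real ^ 'n) set" where
  "open_face F = {\<mu>\<in>belief_simplex. \<forall>i. 0 < \<mu> $ i \<longleftrightarrow> i \<in> F}"

abbreviation vertex :: "'n \<Rightarrow> real ^ 'n" where
  "vertex \<theta> \<equiv> axis \<theta> 1"

definition grad :: "(real ^ 'n \<Rightarrow> real) \<Rightarrow> real ^ 'n \<Rightarrow> real ^ 'n" where
  "grad f x = (\<chi> i. frechet_derivative f (at x) (axis i 1))"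

definition Hess :: "(real ^ 'n \<Rightarrow> real) \<Rightarrow> real ^ 'n \<Rightarrow> real ^ 'n ^ 'n" where
  "Hess f x = (\<chi> i j. grad (\<lambda>y. grad f y $ i) x $ j)"

text \<open>The extension of \<open>H\<close> to the nonnegative orthant, homogeneous of degree one; at the
  origin the prefactor makes it \<open>0\<close>.\<close>

definition hext :: "(real ^ 'n \<Rightarrow> real) \<Rightarrow> real ^ 'n \<Rightarrow> real" where
  "hext H x = (\<Sum>i\<in>UNIV. x $ i) * H (x /\<^sub>R (\<Sum>i\<in>UNIV. x $ i))"

text \<open>Twice continuous differentiability on a set that is open in its affine hull. The
  derivatives are taken within the set, so only their action on tangent directions is
  determined; the gradient and the Hessian are therefore quantified existentially.\<close>

definition C2_on :: "(real ^ 'n \<Rightarrow> real) \<Rightarrow> (real ^ 'n) set \<Rightarrow> bool" where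
  "C2_on f S \<longleftrightarrow> (\<exists>(g :: real ^ 'n \<Rightarrow> real ^ 'n) (h :: real ^ 'n \<Rightarrow> real ^ 'n ^ 'n).
     (\<forall>x\<in>S. (f has_derivative (\<lambda>v. g x \<bullet> v)) (at x within S)) \<and>
     (\<forall>x\<in>S. (g has_derivative (\<lambda>v. h x *v v)) (at x within S)) \<and>
     continuous_on S h)"

definition strictly_convex_on :: "(real ^ 'n) set \<Rightarrow> (real ^ 'n \<Rightarrow> real) \<Rightarrow> bool" where
  "strictly_convex_on S f \<longleftrightarrow> convex S \<and>
     (\<forall>x\<in>S. \<forall>y\<in>S. \<forall>u. x \<noteq> y \<and> 0 < u \<and> u < 1 \<longrightarrow>
        f (u *\<^sub>R x + (1 - u) *\<^sub>R y) < u * f x + (1 - u) * f y)"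

definition irreducible_entropy :: "(real ^ 'n \<Rightarrow> real) \<Rightarrow> bool" where
  "irreducible_entropy H \<longleftrightarrow> (\<forall>\<mu>\<in>interior_simplex. \<forall>\<theta> \<theta>'.
     (\<theta>, \<theta>') \<in> {(a, b). a \<noteq> b \<and> Hess (hext H) \<mu> $ a $ b \<noteq> 0}\<^sup>*)"

text \<open>Smoothness on the simplex is required on the relative interior of every face (the full
  simplex included), together with continuity on the whole simplex. This is implied by
  smoothness up to the boundary, and it also admits entropies whose gradient blows up at the
  boundary, such as \<open>\<Sum>i. \<mu>\<^sub>i ln \<mu>\<^sub>i\<close>.\<close>

definition entropy_fun :: "(real ^ 'n \<Rightarrow> real) \<Rightarrow> bool" where
  "entropy_fun H \<longleftrightarrow>
     strictly_convex_on belief_simplex H \<and> continuous_on belief_simplex H \<and>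
     (\<forall>F. F \<noteq> {} \<longrightarrow> C2_on H (open_face F)) \<and>
     irreducible_entropy H"

section \<open>Bregman divergence\<close>

definition bregman :: "(real ^ 'n \<Rightarrow> real) \<Rightarrow> real ^ 'n \<Rightarrow> real ^ 'n \<Rightarrow> real" where
  "bregman H \<mu>' \<mu> = hext H \<mu>' - hext H \<mu> - grad (hext H) \<mu> \<bullet> (\<mu>' - \<mu>)"

text \<open>The divergence on the closed simplex. At boundary beliefs, where the extension need not be
  differentiable, the term \<open>\<nabla>H(\<mu>) \<cdot> (\<mu>' - \<mu>)\<close> is read as the one-sided directional derivative,
  which exists in \<open>[-\<infinity>,\<infinity>)\<close> by convexity and equals the gradient term whenever the gradient
  exists; so the divergence may be \<open>\<infinity>\<close> there.\<close>

definition slope :: "(real ^ 'n \<Rightarrow> real) \<Rightarrow> real ^ 'n \<Rightarrow> real ^ 'n \<Rightarrow> ereal" where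
  "slope f x v = Lim (at_right 0) (\<lambda>h. ereal ((f (x + h *\<^sub>R v) - f x) / h))"

definition divergence :: "(real ^ 'n \<Rightarrow> real) \<Rightarrow> real ^ 'n \<Rightarrow> real ^ 'n \<Rightarrow> ereal" where
  "divergence H \<mu>' \<mu> = (if \<mu> \<in> interior_simplex then ereal (bregman H \<mu>' \<mu>)
     else ereal (H \<mu>' - H \<mu>) - slope (hext H) \<mu> (\<mu>' - \<mu>))"

definition minD :: "(real ^ 'n \<Rightarrow> real) \<Rightarrow> real ^ 'n \<Rightarrow> ereal" where
  "minD H \<mu> = Min (range (\<lambda>\<theta>. divergence H (vertex \<theta>) \<mu>))"

definition argminD :: "(real ^ 'n \<Rightarrow> real) \<Rightarrow> real ^ 'n \<Rightarrow> 'n set" where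
  "argminD H \<mu> = {\<theta>. divergence H (vertex \<theta>) \<mu> = minD H \<mu>}"

definition D_assumptions :: "(real ^ 'n \<Rightarrow> real) \<Rightarrow> bool" where
  "D_assumptions H \<longleftrightarrow>
     (SUP \<mu>\<in>belief_simplex. minD H \<mu>) < \<infinity> \<and>
     (\<exists>\<epsilon>>0. \<forall>\<mu>\<in>belief_simplex. \<forall>\<theta>. \<mu> $ \<theta> \<le> \<epsilon> \<longrightarrow>
        divergence H (vertex \<theta>) \<mu> > Min ((\<lambda>\<theta>'. divergence H (vertex \<theta>') \<mu>) ` (UNIV - {\<theta>}))) \<and>
     (\<forall>\<mu>\<in>interior_simplex. \<forall>\<theta> \<theta>'. \<theta> \<noteq> \<theta>' \<longrightarrow>
        (vertex \<theta> - \<mu>) \<bullet> grad (\<lambda>x. bregman H (vertex \<theta>') x) \<mu> \<ge> 0)"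

section \<open>Greedy exploration\<close>

text \<open>Data of the recursion: stage starting times \<open>start k\<close> (\<open>\<infinity>\<close> if the stage is never reached),
  active sets \<open>A k\<close>, Poisson rates \<open>\<beta> t \<theta>\<close> and the no-breakthrough path \<open>muhat t\<close>. Stages are
  counted from \<open>0\<close>; inactive states have rate \<open>0\<close>.\<close>

definition stage :: "(nat \<Rightarrow> ereal) \<Rightarrow> nat \<Rightarrow> real set" where
  "stage start k = {t. start k \<le> ereal t \<and> ereal t < start (Suc k)}"

definition entry_times ::
  "(real ^ 'n \<Rightarrow> real) \<Rightarrow> (nat \<Rightarrow> ereal) \<Rightarrow> (nat \<Rightarrow> 'n set) \<Rightarrow> (real \<Rightarrow> real ^ 'n) \<Rightarrow> nat \<Rightarrow> ereal set"
  where
  "entry_times H start A muhat k =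
     ereal ` {t. start k \<le> ereal t \<and> \<not> argminD H (muhat t) \<subseteq> A k}"

definition greedy_path ::
  "(real ^ 'n \<Rightarrow> real) \<Rightarrow> real \<Rightarrow> real ^ 'n \<Rightarrow> (nat \<Rightarrow> ereal) \<Rightarrow> (nat \<Rightarrow> 'n set) \<Rightarrow>
   (real \<Rightarrow> 'n \<Rightarrow> real) \<Rightarrow> (real \<Rightarrow> real ^ 'n) \<Rightarrow> bool" where
  "greedy_path H chi \<mu>0 start A \<beta> muhat \<longleftrightarrow>
     start 0 = 0 \<and> muhat 0 = \<mu>0 \<and>
     continuous_on {0..} muhat \<and> (\<forall>t\<ge>0. muhat t \<in> belief_simplex) \<and>
     (\<forall>t\<ge>0. \<forall>\<theta>. 0 \<le> \<beta> t \<theta>) \<and>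
     (\<forall>k. start k < \<infinity> \<longrightarrow> A k = argminD H (muhat (real_of_ereal (start k)))) \<and>
     (\<forall>k. start k < \<infinity> \<and> A k \<noteq> UNIV \<longrightarrow>
        (\<forall>t\<in>stage start k.
           (\<forall>\<theta>\<in>A k. \<forall>\<theta>'\<in>A k. divergence H (vertex \<theta>) (muhat t) = divergence H (vertex \<theta>') (muhat t)) \<and>
           (\<Sum>\<theta>\<in>A k. ereal (\<beta> t \<theta>) * divergence H (vertex \<theta>) (muhat t)) = ereal chi \<and>
           (\<forall>\<theta>. \<theta> \<notin> A k \<longrightarrow> \<beta> t \<theta> = 0) \<and>
           (muhat has_vector_derivative - (\<Sum>\<theta>\<in>A k. \<beta> t \<theta> *\<^sub>R (vertex \<theta> - muhat t)))
             (at t within stage start k)) \<and>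
        (if entry_times H start A muhat k = {} then start (Suc k) = \<infinity>
         else start (Suc k) \<in> entry_times H start A muhat k \<and>
              (\<forall>s\<in>entry_times H start A muhat k. start (Suc k) \<le> s))) \<and>
     (\<forall>k. start k < \<infinity> \<and> A k = UNIV \<longrightarrow>
        start (Suc k) = \<infinity> \<and>
        (\<forall>t\<in>stage start k.
           muhat t = muhat (real_of_ereal (start k)) \<and>
           (\<forall>\<theta>. \<beta> t \<theta> = chi / real_of_ereal (divergence H (vertex \<theta>) (muhat t)) * muhat t $ \<theta>)))"

text \<open>The minimal divergence along the path; it is finite by the first of the \<open>D_assumptions\<close>.\<close>

definition zeta :: "(real ^ 'n \<Rightarrow> real) \<Rightarrow> (real \<Rightarrow> real ^ 'n) \<Rightarrow> real \<Rightarrow> real" where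
  "zeta H muhat t = real_of_ereal (minD H (muhat t))"

text \<open>A Poisson counter with deterministic, time-varying arrival rate. The law of the increments is
  written out because \<open>poisson_pmf\<close> requires a positive rate, and the rate may vanish here.\<close>

definition poisson_counter :: "'w measure \<Rightarrow> (real \<Rightarrow> real) \<Rightarrow> (real \<Rightarrow> 'w \<Rightarrow> nat) \<Rightarrow> bool" where
  "poisson_counter M rate N \<longleftrightarrow>
     (\<forall>t\<ge>0. N t \<in> measurable M (count_space UNIV)) \<and>
     (AE \<omega> in M. N 0 \<omega> = 0 \<and> (\<forall>s t. 0 \<le> s \<and> s \<le> t \<longrightarrow> N s \<omega> \<le> N t \<omega>) \<and>
        (\<forall>t\<ge>0. ((\<lambda>u. N u \<omega>) \<longlongrightarrow> N t \<omega>) (at_right t))) \<and>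
     (\<forall>ts :: nat \<Rightarrow> real. \<forall>m. 0 \<le> ts 0 \<and> mono ts \<longrightarrow>
        prob_space.indep_vars M (\<lambda>_. count_space UNIV)
          (\<lambda>i \<omega>. N (ts (Suc i)) \<omega> - N (ts i) \<omega>) {..<m}) \<and>
     (\<forall>s t. 0 \<le> s \<and> s \<le> t \<longrightarrow> rate integrable_on {s..t} \<and>
        (\<forall>k. measure M {\<omega>\<in>space M. N t \<omega> - N s \<omega> = k} =
           integral {s..t} rate ^ k / fact k * exp (- integral {s..t} rate)))"

definition independent_counters ::
  "'w measure \<Rightarrow> (real \<Rightarrow> 'n::finite \<Rightarrow> real) \<Rightarrow> ('n \<Rightarrow> real \<Rightarrow> 'w \<Rightarrow> nat) \<Rightarrow> bool" where
  "independent_counters M \<beta> Q \<longleftrightarrow>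
     (\<forall>\<theta>. poisson_counter M (\<lambda>t. \<beta> t \<theta>) (Q \<theta>)) \<and>
     prob_space.indep_vars M (\<lambda>_. PiM {0..} (\<lambda>_. count_space UNIV))
       (\<lambda>\<theta> \<omega>. \<lambda>t\<in>{0..}. Q \<theta> t \<omega>) UNIV"

definition first_arrival :: "('n \<Rightarrow> real \<Rightarrow> 'w \<Rightarrow> nat) \<Rightarrow> 'w \<Rightarrow> 'n \<Rightarrow> real \<Rightarrow> bool" where
  "first_arrival Q \<omega> \<theta> s \<longleftrightarrow>
     0 \<le> s \<and> 0 < Q \<theta> s \<omega> \<and> (\<forall>u. 0 \<le> u \<and> u < s \<longrightarrow> (\<forall>\<theta>'. Q \<theta>' u \<omega> = 0))"

text \<open>The compensated Poisson belief process, described pathwise: it follows \<open>muhat\<close> before the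
  first arrival, jumps to the vertex of the arriving counter and stays there. Simultaneous
  arrivals are a null event.\<close>

definition greedy_process ::
  "'w measure \<Rightarrow> ('n \<Rightarrow> real \<Rightarrow> 'w \<Rightarrow> nat) \<Rightarrow> (real \<Rightarrow> real ^ 'n) \<Rightarrow> (real \<Rightarrow> 'w \<Rightarrow> real ^ 'n) \<Rightarrow> bool"
  where
  "greedy_process M Q muhat X \<longleftrightarrow> (AE \<omega> in M.
     (\<forall>t\<ge>0. (\<forall>\<theta>. Q \<theta> t \<omega> = 0) \<longrightarrow> X t \<omega> = muhat t) \<and>
     (\<forall>\<theta> s. first_arrival Q \<omega> \<theta> s \<longrightarrow> (\<forall>t\<ge>s. X t \<omega> = vertex \<theta>)))"

definition stop_time :: "(real \<Rightarrow> 'w \<Rightarrow> real ^ 'n) \<Rightarrow> 'w \<Rightarrow> ereal" where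
  "stop_time X \<omega> = Inf (ereal ` {t. 0 \<le> t \<and> X t \<omega> \<in> range vertex})"

text \<open>A density is only determined almost everywhere, while prices involve its values at points:
  the version meant is the one continuous on \<open>[0,\<infinity>)\<close>. Finiteness of the stopping time need not
  be stated: \<open>real_of_ereal\<close> maps \<open>\<infinity>\<close> to \<open>0\<close>, so non-stopping with positive probability would
  produce an atom.\<close>

definition stopping_density ::
  "'w measure \<Rightarrow> (real \<Rightarrow> 'w \<Rightarrow> real ^ 'n) \<Rightarrow> (real \<Rightarrow> real) \<Rightarrow> bool" where
  "stopping_density M X f \<longleftrightarrow>
     stop_time X \<in> borel_measurable M \<and>
     (\<forall>t. 0 \<le> f t) \<and> continuous_on {0..} f \<and>
     distributed M lborel (\<lambda>\<omega>. real_of_ereal (stop_time X \<omega>)) (\<lambda>t. ennreal (f t))"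

definition hazard_rate :: "'w measure \<Rightarrow> ('w \<Rightarrow> ereal) \<Rightarrow> (real \<Rightarrow> real) \<Rightarrow> real \<Rightarrow> real" where
  "hazard_rate M \<tau> f t = f t / measure M {\<omega>\<in>space M. ereal t < \<tau> \<omega>}"

section \<open>Types and the service-quota menu\<close>

definition type_distribution ::
  "real \<Rightarrow> real \<Rightarrow> (real \<Rightarrow> real) \<Rightarrow> (real \<Rightarrow> real) \<Rightarrow> bool" where
  "type_distribution rl rh G g \<longleftrightarrow>
     g \<in> borel_measurable borel \<and> (\<forall>r. 0 \<le> g r) \<and> (\<forall>r. r \<notin> {rl..rh} \<longrightarrow> g r = 0) \<and>
     prob_space (density lborel (\<lambda>r. ennreal (g r))) \<and>
     G = cdf (density lborel (\<lambda>r. ennreal (g r)))"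

definition time_cap :: "real \<Rightarrow> (real \<Rightarrow> real) \<Rightarrow> (real \<Rightarrow> real) \<Rightarrow> real \<Rightarrow> ereal" where
  "time_cap rl G g r = (if r = rl then \<infinity> else ereal (g r / G r))"

definition transfer_price ::
  "real \<Rightarrow> (real \<Rightarrow> real) \<Rightarrow> (real \<Rightarrow> ereal) \<Rightarrow> real \<Rightarrow> real" where
  "transfer_price rh f T r =
     (LINT t:{t. 0 \<le> t \<and> ereal t \<le> T r}|lborel. exp (- (r * t)) * f t) -
     (LINT z:{r..rh}|lborel.
        (LINT t:{t. 0 \<le> t \<and> ereal t \<le> T z}|lborel. exp (- (z * t)) * t * f t))"

text \<open>\<open>m = P'(r) / T'(r)\<close>, with derivatives relative to \<open>S\<close> (one-sided at an end point of \<open>S\<close>).\<close>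

definition marginal_price ::
  "(real \<Rightarrow> real) \<Rightarrow> (real \<Rightarrow> real) \<Rightarrow> real set \<Rightarrow> real \<Rightarrow> real \<Rightarrow> bool" where
  "marginal_price P T S r m \<longleftrightarrow> (\<exists>P' T'.
     (P has_real_derivative P') (at r within S) \<and>
     (T has_real_derivative T') (at r within S) \<and> T' \<noteq> 0 \<and> m = P' / T')"

end

theory Submission
  imports Defs
begin

text \<open>The prior may lie on the boundary of the simplex, so everything is done on the open face \<open>F\<close>
  carrying it. By the second assumption on \<open>D\<close> only states of belief above \<open>\<epsilon>\<close> can be active, and
  the inactive coordinates solve \<open>x' = (\<Sum>\<beta>) x\<close>, so the path never leaves that face.

  Along a stage with active set \<open>A\<close> all \<open>D(e\<^sub>\<theta> | \<mu>)\<close>, \<open>\<theta> \<in> A\<close>, equal \<open>\<zeta>\<close>, and the derivative of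
  each of them is \<open>- (Hess H \<cdot> v) \<bullet> (e\<^sub>\<theta> - \<mu>)\<close> with velocity \<open>v = - (\<Sum>\<theta>. \<beta>\<^sub>\<theta> (e\<^sub>\<theta> - \<mu>))\<close>. Averaging
  with the weights \<open>\<beta>\<^sub>\<theta>\<close> gives \<open>(\<Sum>\<beta>) \<zeta>' = (Hess H \<cdot> v) \<bullet> v \<ge> 0\<close>, so \<open>\<zeta>\<close> is non-decreasing by
  convexity alone. Active sets grow strictly, so finitely many stages cover \<open>[0,\<infinity>)\<close>.

  The survival function is \<open>exp (- \<integral>\<chi>/\<zeta>)\<close>; since the density is continuous it equals
  \<open>\<chi>/\<zeta>\<close> times that, which is strictly decreasing. In \<open>P'\<close> the derivative of the discount factor
  cancels against the derivative of the outer integral, leaving only the term with \<open>T'\<close>.\<close>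

section \<open>Divergence on an open face\<close>

text \<open>\<open>S\<close> may have empty interior, as proper faces of the simplex do, so only
  directions staying in \<open>S\<close> are tested. Along such a ray the chain rule gives a
  one-variable derivative within \<open>U\<close>, and \<open>at_right 0\<close> is a finer filter
  than \<open>at 0 within U\<close>.\<close>

lemma has_derivative_imp_directional:
  fixes f :: "'a::real_normed_vector \<Rightarrow> real"
  assumes f: "(f has_derivative f') (at x within S)"
    and ev: "eventually (\<lambda>u. x + u *\<^sub>R v \<in> S) (at_right 0)"
  shows "((\<lambda>u. (f (x + u *\<^sub>R v) - f x) / u) \<longlongrightarrow> f' v) (at_right 0)"
proof -
  define U where "U = {u. 0 \<le> u \<and> x + u *\<^sub>R v \<in> S}"
  have "((\<lambda>u. x + u *\<^sub>R v) has_derivative (\<lambda>u. u *\<^sub>R v)) (at 0 within U)"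
    by (auto intro!: derivative_eq_intros)
  moreover have "(f has_derivative f') (at (x + 0 *\<^sub>R v) within ((\<lambda>u. x + u *\<^sub>R v) ` U))"
    using f by (auto intro: has_derivative_subset simp: U_def)
  ultimately have "((\<lambda>u. f (x + u *\<^sub>R v)) has_derivative (\<lambda>u. f' (u *\<^sub>R v))) (at 0 within U)"
    using diff_chain_within[of "\<lambda>u. x + u *\<^sub>R v" "\<lambda>u. u *\<^sub>R v" 0 U f f'] by (simp add: o_def)
  moreover have "f' (u *\<^sub>R v) = f' v * u" for u
    using linear_scale[OF has_derivative_linear[OF f]] by simp
  ultimately have "((\<lambda>u. f (x + u *\<^sub>R v)) has_real_derivative f' v) (at 0 within U)"
    by (simp add: has_field_derivative_def)
  then have "((\<lambda>u. (f (x + u *\<^sub>R v) - f x) / u) \<longlongrightarrow> f' v) (at 0 within U)"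
    by (simp add: has_field_derivative_iff)
  moreover have "at_right 0 \<le> at 0 within U"
    unfolding at_within_def[of 0 U] le_inf_iff
    using ev by (auto simp: le_principal at_within_le_nhds U_def eventually_at_filter elim!: eventually_mono)
  ultimately show ?thesis
    by (rule tendsto_mono[rotated])
qed

text \<open>These are the tangent directions of the face: coordinates off \<open>F\<close> stay
  \<open>0\<close>, the sum stays \<open>1\<close>, and the finitely many positive coordinates
  remain positive for a small step.\<close>

lemma open_face_shift:
  fixes x v :: "real ^ 'n"
  assumes x: "x \<in> open_face F" and v: "(\<Sum>i\<in>UNIV. v $ i) = 0" "\<And>i. i \<notin> F \<Longrightarrow> v $ i = 0"
  shows "eventually (\<lambda>u. x + u *\<^sub>R v \<in> open_face F) (at_right 0)"
proof -
  have pos: "0 < x $ i" if "i \<in> F" for i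
    using x that by (auto simp: open_face_def)
  have zero: "x $ i = 0" if "i \<notin> F" for i
    using x that by (auto simp: open_face_def belief_simplex_def order.order_iff_strict)
  have "eventually (\<lambda>u. 0 < x $ i + u * v $ i) (at_right 0)" if "i \<in> F" for i
  proof -
    have "((\<lambda>u. x $ i + u * v $ i) \<longlongrightarrow> x $ i + 0 * v $ i) (at_right 0)"
      by (intro tendsto_intros)
    then show ?thesis
      using pos[OF that] by (auto dest: order_tendstoD(1)[where a=0])
  qed
  then have "eventually (\<lambda>u. \<forall>i\<in>F. 0 < x $ i + u * v $ i) (at_right 0)"
    by (simp add: eventually_ball_finite)
  then show ?thesis
  proof eventually_elim
    case (elim u)
    have "(\<Sum>i\<in>UNIV. x $ i + u * v $ i) = 1"
      using x v by (simp add: sum.distrib sum_distrib_left[symmetric] open_face_def belief_simplex_def)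
    moreover have "0 \<le> x $ i + u * v $ i \<and> (0 < x $ i + u * v $ i \<longleftrightarrow> i \<in> F)" for i
      using elim zero v(2) by (cases "i \<in> F") (auto simp: less_imp_le)
    ultimately show ?case
      by (simp add: open_face_def belief_simplex_def)
  qed
qed

lemma open_face_tangent:
  fixes x :: "real ^ 'n"
  assumes "x \<in> open_face F" and "\<theta> \<in> F"
  shows "(\<Sum>i\<in>UNIV. (vertex \<theta> - x) $ i) = 0" and "i \<notin> F \<Longrightarrow> (vertex \<theta> - x) $ i = 0"
  using assms
  by (auto simp: open_face_def belief_simplex_def axis_def sum_subtractf order.order_iff_strict)

lemma vertex_in_belief_simplex [simp]: "(vertex \<theta> :: real ^ 'n) \<in> belief_simplex"
  by (auto simp: belief_simplex_def axis_def)

lemma open_face_subset: "open_face F \<subseteq> belief_simplex"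
  by (auto simp: open_face_def)

lemma hext_on_belief_simplex: "(\<Sum>i\<in>UNIV. x $ i) = 1 \<Longrightarrow> hext H x = H x"
  by (simp add: hext_def)

text \<open>The derivative of \<open>H\<close> is given only within the simplex, whereas
  \<open>grad\<close> needs a full neighbourhood. Normalisation \<open>y /\<^sub>R s y\<close> sends
  the open positive orthant into the open simplex, so \<open>hext H\<close> is the product of
  \<open>s\<close> with a composition differentiable at \<open>x\<close>.\<close>

lemma hext_differentiable:
  fixes x :: "real ^ 'n"
  assumes x: "x \<in> interior_simplex"
    and H: "(H has_derivative H') (at x within open_face UNIV)"
  shows "hext H differentiable (at x)"
proof -
  define U where "U = (\<Inter>i. {y :: real ^ 'n. 0 < y $ i})"
  define s where "s = (\<lambda>y :: real ^ 'n. \<Sum>i\<in>UNIV. y $ i)"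
  have U: "open U" unfolding U_def
    by (intro open_INT ballI open_Collect_less continuous_intros) auto
  have xU: "x \<in> U" and sx: "s x = 1"
    using x by (auto simp: U_def s_def interior_simplex_def belief_simplex_def)
  have spos: "0 < s y" if "y \<in> U" for y
    using that by (auto simp: s_def U_def intro!: sum_pos)
  have sub: "(\<lambda>y. y /\<^sub>R s y) ` U \<subseteq> open_face UNIV"
  proof safe
    fix y assume y: "y \<in> U"
    have "(\<Sum>i\<in>UNIV. (y /\<^sub>R s y) $ i) = 1"
      using spos[OF y] by (simp add: sum_distrib_left[symmetric]) (simp add: s_def)
    then show "y /\<^sub>R s y \<in> open_face UNIV"
      using y spos[OF y] by (auto simp: open_face_def belief_simplex_def U_def less_imp_le)
  qed
  have s: "s differentiable (at x within U)"
    unfolding s_def by (intro differentiable_sum ballI) (auto intro!: bounded_linear_imp_differentiable bounded_linear_vec_nth)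
  then have p: "(\<lambda>y. y /\<^sub>R s y) differentiable (at x within U)"
    by (intro differentiable_scaleR differentiable_inverse) (auto simp: sx)
  have "H differentiable (at (x /\<^sub>R s x) within ((\<lambda>y. y /\<^sub>R s y) ` U))"
    using H sub by (auto simp: sx differentiable_def intro: has_derivative_subset)
  then have "(\<lambda>y. H (y /\<^sub>R s y)) differentiable (at x within U)"
    using differentiable_chain_within[OF p] by (simp add: o_def)
  then have "(\<lambda>y. s y * H (y /\<^sub>R s y)) differentiable (at x within U)"
    using s by (intro differentiable_mult)
  then show ?thesis
    using at_within_open[OF xU U] by (simp add: hext_def[abs_def] s_def)
qed

lemma grad_inner:
  fixes f :: "real ^ 'n \<Rightarrow> real"
  assumes "f differentiable (at x)"
  shows "grad f x \<bullet> v = frechet_derivative f (at x) v"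
proof -
  interpret linear "frechet_derivative f (at x)"
    by (rule linear_frechet_derivative[OF assms])
  have "frechet_derivative f (at x) v = frechet_derivative f (at x) (\<Sum>i\<in>UNIV. v $ i *\<^sub>R axis i 1)"
    by (simp add: basis_expansion flip: scalar_mult_eq_scaleR)
  also have "\<dots> = (\<Sum>i\<in>UNIV. v $ i * frechet_derivative f (at x) (axis i 1))"
    by (simp add: sum scale)
  finally show ?thesis
    by (simp add: grad_def inner_vec_def mult.commute)
qed

text \<open>The directional derivative along a ray in the face is a unique limit. At interior
  beliefs it identifies \<open>grad (hext H) x\<close> with \<open>g\<close> in the direction of the
  vertex; elsewhere it is \<open>slope\<close> itself. Both branches of \<open>divergence\<close>
  thus give the same finite value, for any \<open>g\<close> representing the derivative.\<close>

lemma divergence_on_open_face: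
  fixes x :: "real ^ 'n"
  assumes x: "x \<in> open_face F" and \<theta>: "\<theta> \<in> F"
    and H: "(H has_derivative (\<lambda>v. g \<bullet> v)) (at x within open_face F)"
  shows "divergence H (vertex \<theta>) x = ereal (H (vertex \<theta>) - H x - g \<bullet> (vertex \<theta> - x))"
proof -
  let ?v = "vertex \<theta> - x"
  note tan = open_face_tangent[OF x \<theta>]
  have sx: "(\<Sum>i\<in>UNIV. x $ i) = 1"
    using x by (auto simp: open_face_def belief_simplex_def)
  have sxu: "(\<Sum>i\<in>UNIV. (x + u *\<^sub>R ?v) $ i) = 1" for u
    using sx tan(1) by (simp add: sum.distrib sum_distrib_left[symmetric])
  have ev: "eventually (\<lambda>u. x + u *\<^sub>R ?v \<in> open_face F) (at_right 0)"
    by (rule open_face_shift[OF x]) (fact tan)+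
  have lim: "((\<lambda>u. (hext H (x + u *\<^sub>R ?v) - hext H x) / u) \<longlongrightarrow> g \<bullet> ?v) (at_right 0)"
    using has_derivative_imp_directional[OF H ev]
    by (simp only: hext_on_belief_simplex[OF sx] hext_on_belief_simplex[OF sxu])
  show ?thesis
  proof (cases "x \<in> interior_simplex")
    case True
    then have F: "F = UNIV"
      using x by (auto simp: interior_simplex_def open_face_def)
    have diff: "hext H differentiable (at x)"
      using hext_differentiable[OF True] H F by auto
    have "((\<lambda>u. (hext H (x + u *\<^sub>R ?v) - hext H x) / u) \<longlongrightarrow> frechet_derivative (hext H) (at x) ?v) (at_right 0)"
      using has_derivative_imp_directional[OF diff[unfolded frechet_derivative_works]] by simp
    then have "grad (hext H) x \<bullet> ?v = g \<bullet> ?v"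
      using tendsto_unique[OF _ lim] grad_inner[OF diff] by auto
    then show ?thesis
      using True sx by (simp add: divergence_def bregman_def hext_on_belief_simplex axis_def)
  next
    case False
    have "slope (hext H) x ?v = ereal (g \<bullet> ?v)"
      unfolding slope_def using lim by (intro tendsto_Lim) auto
    then show ?thesis
      using False by (simp add: divergence_def)
  qed
qed

section \<open>First- and second-order consequences of strict convexity\<close>

lemma open_face_segment:
  fixes x y :: "real ^ 'n"
  assumes x: "x \<in> open_face F" and y: "y \<in> belief_simplex" "\<And>i. i \<notin> F \<Longrightarrow> y $ i = 0"
    and u: "0 \<le> u" "u < 1"
  shows "x + u *\<^sub>R (y - x) \<in> open_face F"
proof -
  have eq: "(x + u *\<^sub>R (y - x)) $ i = (1 - u) * x $ i + u * y $ i" for i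
    by (simp add: algebra_simps)
  have zero: "x $ i = 0" if "i \<notin> F" for i
    using x that by (auto simp: open_face_def belief_simplex_def order.order_iff_strict)
  have "(\<Sum>i\<in>UNIV. (1 - u) * x $ i + u * y $ i) = 1"
    using x y by (simp add: sum.distrib sum_distrib_left[symmetric] open_face_def belief_simplex_def)
  moreover have "0 \<le> (1 - u) * x $ i + u * y $ i \<and> (0 < (1 - u) * x $ i + u * y $ i \<longleftrightarrow> i \<in> F)" for i
    using x y u zero[of i] 
    by (cases "i \<in> F") (auto simp: open_face_def belief_simplex_def intro!: add_pos_nonneg add_nonneg_nonneg)
  ultimately show ?thesis
    unfolding open_face_def belief_simplex_def mem_Collect_eq eq by auto
qed

text \<open>Chord slopes bound the difference quotients, which gives the weak inequality in the
  limit. Using it at the midpoint \<open>m\<close>, where convexity is strict, makes it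
  strict.\<close>

lemma strictly_convex_on_gradient:
  fixes x y :: "real ^ 'n"
  assumes conv: "strictly_convex_on belief_simplex H"
    and x: "x \<in> open_face F" and y: "y \<in> belief_simplex" "\<And>i. i \<notin> F \<Longrightarrow> y $ i = 0" "x \<noteq> y"
    and H: "(H has_derivative (\<lambda>v. g \<bullet> v)) (at x within open_face F)"
  shows "g \<bullet> (y - x) < H y - H x"
proof -
  have xb: "x \<in> belief_simplex" using x open_face_subset by blast
  have weak: "g \<bullet> (z - x) \<le> H z - H x" 
    if z: "z \<in> belief_simplex" "\<And>i. i \<notin> F \<Longrightarrow> z $ i = 0" "x \<noteq> z" for z
  proof (rule tendsto_upperbound)
    show "((\<lambda>u. (H (x + u *\<^sub>R (z - x)) - H x) / u) \<longlongrightarrow> g \<bullet> (z - x)) (at_right 0)"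
    proof (rule has_derivative_imp_directional[OF H])
      show "eventually (\<lambda>u. x + u *\<^sub>R (z - x) \<in> open_face F) (at_right 0)"
        using eventually_at_right_real[of 0 "1::real", OF zero_less_one]
        by eventually_elim (auto intro!: open_face_segment[OF x z(1,2)])
    qed
    show "eventually (\<lambda>u. (H (x + u *\<^sub>R (z - x)) - H x) / u \<le> H z - H x) (at_right 0)"
      using eventually_at_right_real[of 0 "1::real", OF zero_less_one]
    proof eventually_elim
      case (elim u)
      have "H (u *\<^sub>R z + (1 - u) *\<^sub>R x) < u * H z + (1 - u) * H x"
        using conv z xb elim by (auto simp: strictly_convex_on_def)
      moreover have "u *\<^sub>R z + (1 - u) *\<^sub>R x = x + u *\<^sub>R (z - x)"
        by (simp add: algebra_simps)
      ultimately have "H (x + u *\<^sub>R (z - x)) - H x \<le> (H z - H x) * u"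
        by (simp add: algebra_simps)
      then show ?case
        using elim by (simp add: divide_le_eq)
    qed
  qed auto
  define m where "m = x + (1/2) *\<^sub>R (y - x)"
  have mF: "m \<in> open_face F"
    unfolding m_def by (rule open_face_segment[OF x y(1,2)]) auto
  have "g \<bullet> (m - x) \<le> H m - H x"
  proof (rule weak)
    show "m \<in> belief_simplex" using mF open_face_subset by blast
    show "m $ i = 0" if "i \<notin> F" for i
      using mF that by (auto simp: open_face_def belief_simplex_def order.order_iff_strict)
    show "x \<noteq> m" using y(3) by (simp add: m_def)
  qed
  moreover have "H ((1/2) *\<^sub>R y + (1 - 1/2) *\<^sub>R x) < (1/2) * H y + (1 - 1/2) * H x"
    using conv y xb unfolding strictly_convex_on_def by (metis half_gt_zero_iff less_numeral_extra(1) field_sum_of_halves less_add_same_cancel1 half_gt_zero)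
  moreover have "(1/2) *\<^sub>R y + (1 - 1/2) *\<^sub>R x = m"
    unfolding m_def by (simp add: algebra_simps vec_eq_iff)
  ultimately show ?thesis
    by (simp add: m_def)
qed

text \<open>Adding the gradient inequalities at \<open>x\<close> and at
  \<open>x + u *\<^sub>R v\<close> shows that the gradient is monotone along \<open>v\<close>. Its
  difference quotients are nonnegative and tend to the quadratic form of \<open>h\<close>.\<close>

lemma strictly_convex_on_Hess_nonneg:
  fixes x v :: "real ^ 'n"
  assumes conv: "strictly_convex_on belief_simplex H"
    and x: "x \<in> open_face F" 
    and v: "(\<Sum>i\<in>UNIV. v $ i) = 0" "\<And>i. i \<notin> F \<Longrightarrow> v $ i = 0"
    and H: "\<And>x. x \<in> open_face F \<Longrightarrow> (H has_derivative (\<lambda>v. g x \<bullet> v)) (at x within open_face F)"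
    and g: "(g has_derivative (\<lambda>v. h *v v)) (at x within open_face F)"
  shows "0 \<le> (h *v v) \<bullet> v"
proof (rule tendsto_lowerbound)
  have ev: "eventually (\<lambda>u. x + u *\<^sub>R v \<in> open_face F) (at_right 0)"
    by (rule open_face_shift[OF x]) (fact v)+
  have "((\<lambda>y. g y \<bullet> v) has_derivative (\<lambda>w. (h *v w) \<bullet> v)) (at x within open_face F)"
    using g by (auto intro!: derivative_eq_intros)
  from has_derivative_imp_directional[OF this ev]
  show "((\<lambda>u. (g (x + u *\<^sub>R v) \<bullet> v - g x \<bullet> v) / u) \<longlongrightarrow> (h *v v) \<bullet> v) (at_right 0)" .
  show "eventually (\<lambda>u. 0 \<le> (g (x + u *\<^sub>R v) \<bullet> v - g x \<bullet> v) / u) (at_right 0)"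
    using ev eventually_at_right_less[of 0]
  proof eventually_elim
    case (elim u)
    let ?y = "x + u *\<^sub>R v"
    have supp: "z $ i = 0" if "z \<in> open_face F" "i \<notin> F" for i and z :: "real ^ 'n"
      using that by (auto simp: open_face_def belief_simplex_def order.order_iff_strict)
    show ?case
    proof (cases "v = 0")
      case False
      then have ne: "x \<noteq> ?y" using elim by auto
      have "g x \<bullet> (?y - x) < H ?y - H x"
        using strictly_convex_on_gradient[OF conv x _ _ ne H[OF x]] elim supp open_face_subset by blast
      moreover have "g ?y \<bullet> (x - ?y) < H x - H ?y"
        using strictly_convex_on_gradient[OF conv elim(1) _ _ ne[symmetric] H[OF elim(1)]] x supp open_face_subset by blast
      ultimately have "u * (g x \<bullet> v) < u * (g ?y \<bullet> v)"
        by simp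
      then show ?thesis
        using elim(2) by simp
    qed simp
  qed
qed simp

section \<open>The path before a breakthrough\<close>

text \<open>Stages are half-open; bounds known before a closing time are carried to it by
  continuity.\<close>

lemma lowerbound_at_right_endpoint:
  fixes \<phi> :: "real \<Rightarrow> real"
  assumes "continuous_on {a..b} \<phi>" "a < b" "\<And>t. a \<le> t \<Longrightarrow> t < b \<Longrightarrow> c \<le> \<phi> t"
  shows "c \<le> \<phi> b"
proof (rule tendsto_lowerbound)
  show "(\<phi> \<longlongrightarrow> \<phi> b) (at b within {a..b})"
    using assms by (auto simp: continuous_on_def)
  show "eventually (\<lambda>t. c \<le> \<phi> t) (at b within {a..b})"
    using assms by (auto simp: eventually_at_filter)
  show "at b within {a..b} \<noteq> bot"
    using assms by (simp add: trivial_limit_within)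
qed

text \<open>The coefficient is only integrable, so \<open>x\<close> is compared with its integral just after its last zero.\<close>

lemma linear_ode_zero:
  fixes x B :: "real \<Rightarrow> real"
  assumes der: "\<And>u. u \<in> {a..b} \<Longrightarrow> (x has_vector_derivative B u * x u) (at u within {a..b})"
    and B: "B integrable_on {a..b}" "\<And>u. u \<in> {a..b} \<Longrightarrow> 0 \<le> B u"
    and x: "\<And>u. u \<in> {a..b} \<Longrightarrow> 0 \<le> x u" and "x a = 0" and "a \<le> b"
  shows "x b = 0"
proof (rule ccontr)
  assume nz: "x b \<noteq> 0"
  have int: "((\<lambda>u. B u * x u) has_integral x d - x c) {c..d}" if "a \<le> c" "c \<le> d" "d \<le> b" for c d
  proof (rule fundamental_theorem_of_calculus[OF that(2)])
    fix u assume "u \<in> {c..d}"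
    with that have "u \<in> {a..b}" "{c..d} \<subseteq> {a..b}" by auto
    then show "(x has_vector_derivative B u * x u) (at u within {c..d})"
      using has_vector_derivative_within_subset der by blast
  qed
  have mono: "x c \<le> x d" if "a \<le> c" "c \<le> d" "d \<le> b" for c d
    using has_integral_nonneg[OF int[OF that]] B(2) x that by auto
  have cont: "continuous_on {a..b} x"
    unfolding continuous_on_eq_continuous_within
    using der by (blast intro: has_vector_derivative_continuous)
  \<comment> \<open>The zero set is compact, so there is a last zero \<open>c\<close>, after which
    \<open>x\<close> is positive.\<close>
  have "closed ({a..b} \<inter> x -` {0})"
    using cont by (intro continuous_closed_preimage) auto
  then have "compact ({a..b} \<inter> ({a..b} \<inter> x -` {0}))"
    by (intro compact_Int_closed) auto
  then have "compact ({a..b} \<inter> x -` {0})"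
    by (simp add: Int_assoc[symmetric])
  moreover have "a \<in> {a..b} \<inter> x -` {0}"
    using \<open>x a = 0\<close> \<open>a \<le> b\<close> by simp
  ultimately obtain c where "c \<in> {a..b} \<inter> x -` {0}" "\<forall>u\<in>{a..b} \<inter> x -` {0}. u \<le> c"
    using compact_attains_sup[of "{a..b} \<inter> x -` {0}"] by blast
  then have c: "c \<in> {a..b}" "x c = 0" "\<And>u. u \<in> {a..b} \<Longrightarrow> x u = 0 \<Longrightarrow> u \<le> c"
    by auto
  then have cb: "c < b" using nz by (cases "c = b") auto
  have Bc: "B integrable_on {c..b}"
    by (rule integrable_subinterval_real[OF B(1)]) (use c in auto)
  have "continuous_on {c..b} (\<lambda>u. integral {c..u} B)"
    by (rule indefinite_integral_continuous_1[OF Bc])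
  then have "((\<lambda>u. integral {c..u} B) \<longlongrightarrow> integral {c..c} B) (at c within {c..b})"
    using cb unfolding continuous_on_def by (metis atLeastAtMost_iff less_imp_le order_refl)
  then have "eventually (\<lambda>u. integral {c..u} B < 1/2) (at c within {c..b})"
    by (intro order_tendstoD) auto
  moreover have "at c within {c..b} = at_right c"
    using cb at_within_Icc_at_right by blast
  ultimately have "eventually (\<lambda>u. integral {c..u} B < 1/2 \<and> c < u \<and> u < b) (at_right c)"
    using eventually_at_right_real[OF cb] by (simp add: eventually_conj_iff)
  then obtain u where u: "integral {c..u} B < 1/2" "c < u" "u < b"
    using eventually_happens'[OF trivial_limit_at_right_real] by blast
  \<comment> \<open>\<open>x\<close> is non-decreasing, so under the integral it can be replaced by
    its value at the right end. As the coefficient has integral below \<open>1/2\<close>, this gives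
    \<open>x u < x u / 2\<close>.\<close>
  have "x u - x c \<le> integral {c..u} B * x u"
  proof (rule has_integral_le[OF int])
    show "((\<lambda>w. B w * x u) has_integral integral {c..u} B * x u) {c..u}"
      by (intro has_integral_mult_left integrable_integral integrable_subinterval_real[OF Bc]) (use u in auto)
    show "B w * x w \<le> B w * x u" if "w \<in> {c..u}" for w
      using that u c B(2) by (intro mult_left_mono mono) auto
  qed (use u c in auto)
  moreover have "0 < x u"
    using c(3)[of u] x[of u] u c(1) by (auto simp: order.order_iff_strict)
  ultimately show False
    using c(2) u mult_strict_right_mono[of "integral {c..u} B" "1/2" "x u"] by simp
qed

text \<open>\<open>g\<close> and \<open>h\<close> represent the first two derivatives of
  \<open>H\<close> within the face and are determined only on tangent directions.
  \<open>rare\<close> is the second assumption on the divergence, integrability of the rates is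
  supplied by the Poisson counters, and a non-degenerate starting belief keeps the divergences
  positive.\<close>

locale greedy_on_face =
  fixes H :: "real ^ 'n \<Rightarrow> real" and chi :: real
    and start :: "nat \<Rightarrow> ereal" and A :: "nat \<Rightarrow> 'n set"
    and \<beta> :: "real \<Rightarrow> 'n \<Rightarrow> real" and muhat :: "real \<Rightarrow> real ^ 'n"
    and F :: "'n set" and g :: "real ^ 'n \<Rightarrow> real ^ 'n" and h :: "real ^ 'n \<Rightarrow> real ^ 'n ^ 'n"
    and eps :: real
  assumes chi: "0 < chi"
    and conv: "strictly_convex_on belief_simplex H"
    and H_derivative: "\<And>x. x \<in> open_face F \<Longrightarrow>
      (H has_derivative (\<lambda>v. g x \<bullet> v)) (at x within open_face F)"
    and g_derivative: "\<And>x. x \<in> open_face F \<Longrightarrow>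
      (g has_derivative (\<lambda>v. h x *v v)) (at x within open_face F)"
    and eps: "0 < eps"
    and rare: "\<And>\<mu> \<theta>. \<mu> \<in> belief_simplex \<Longrightarrow> \<mu> $ \<theta> \<le> eps \<Longrightarrow>
      Min ((\<lambda>\<theta>'. divergence H (vertex \<theta>') \<mu>) ` (UNIV - {\<theta>})) < divergence H (vertex \<theta>) \<mu>"
    and path: "greedy_path H chi (muhat 0) start A \<beta> muhat"
    and muhat0: "muhat 0 \<in> open_face F" "muhat 0 \<notin> range vertex"
    and rates_integrable: "\<And>s t \<theta>. 0 \<le> s \<Longrightarrow> s \<le> t \<Longrightarrow> (\<lambda>u. \<beta> u \<theta>) integrable_on {s..t}"
begin

text \<open>The real value of \<open>divergence H (vertex \<theta>)\<close> at beliefs on the face,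
  for \<open>\<theta> \<in> F\<close>; for other states the expression may depend on the choice of
  \<open>g\<close>.\<close>

definition D :: "'n \<Rightarrow> real ^ 'n \<Rightarrow> real" where
  "D \<theta> x = H (vertex \<theta>) - H x - g x \<bullet> (vertex \<theta> - x)"

definition total_rate :: "real \<Rightarrow> real" where
  "total_rate t = (\<Sum>\<theta>\<in>UNIV. \<beta> t \<theta>)"

abbreviation \<zeta> :: "real \<Rightarrow> real" where
  "\<zeta> \<equiv> zeta H muhat"

text \<open>A vertex in the open face forces \<open>F\<close> to be a singleton, and the starting
  belief, carried by the same face, would then be that vertex.\<close>

lemma not_vertex: "x \<in> open_face F \<Longrightarrow> x \<noteq> vertex \<theta>"
proof
  assume "x \<in> open_face F" "x = vertex \<theta>"
  then have "F = {\<theta>}"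
    by (auto simp: open_face_def axis_def split: if_splits)
  then have "\<forall>i. i \<noteq> \<theta> \<longrightarrow> muhat 0 $ i = 0" and sum: "(\<Sum>i\<in>UNIV. muhat 0 $ i) = 1"
    using muhat0(1) by (auto simp: open_face_def belief_simplex_def order.order_iff_strict)
  then have "(\<Sum>i\<in>UNIV. muhat 0 $ i) = (\<Sum>i\<in>{\<theta>}. muhat 0 $ i)"
    by (intro sum.mono_neutral_right) auto
  then have "muhat 0 = vertex \<theta>"
    using sum \<open>\<forall>i. i \<noteq> \<theta> \<longrightarrow> muhat 0 $ i = 0\<close> by (auto simp: vec_eq_iff axis_def)
  then show False using muhat0(2) by blast
qed

lemma vertex_off_face: "\<theta> \<in> F \<Longrightarrow> i \<notin> F \<Longrightarrow> vertex \<theta> $ i = (0::real)"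
  by (auto simp: axis_def)

lemma D_pos:
  assumes x: "x \<in> open_face F" and \<theta>: "\<theta> \<in> F"
  shows "0 < D \<theta> x"
proof -
  have "g x \<bullet> (vertex \<theta> - x) < H (vertex \<theta>) - H x"
    by (rule strictly_convex_on_gradient[OF conv x vertex_in_belief_simplex vertex_off_face[OF \<theta>]
          not_vertex[OF x] H_derivative[OF x]])
  then show ?thesis by (simp add: D_def)
qed

lemma divergence_eq: "x \<in> open_face F \<Longrightarrow> \<theta> \<in> F \<Longrightarrow> divergence H (vertex \<theta>) x = ereal (D \<theta> x)"
  using divergence_on_open_face[OF _ _ H_derivative] by (simp add: D_def)

lemma minD_le: "minD H x \<le> divergence H (vertex \<theta>) x"
  by (simp add: minD_def)

lemma argminD_nonempty: "argminD H x \<noteq> {}"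
proof -
  have "Min (range (\<lambda>\<theta>. divergence H (vertex \<theta>) x)) \<in> range (\<lambda>\<theta>. divergence H (vertex \<theta>) x)"
    by (intro Min_in) auto
  then show ?thesis
    by (force simp: argminD_def minD_def)
qed

lemma argminD_above:
  assumes "x \<in> belief_simplex" "x \<noteq> vertex \<theta>" "\<theta> \<in> argminD H x"
  shows "eps < x $ \<theta>"
proof (rule ccontr)
  assume "\<not> eps < x $ \<theta>"
  then have lt: "Min ((\<lambda>\<theta>'. divergence H (vertex \<theta>') x) ` (UNIV - {\<theta>})) < divergence H (vertex \<theta>) x"
    using rare[OF assms(1)] by simp
  \<comment> \<open>\<open>Min\<close> of the empty set carries no information. With a single state
    the simplex consists of the vertex alone, which is excluded.\<close>
  have ne: "UNIV - {\<theta>} \<noteq> {}"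
  proof
    assume "UNIV - {\<theta>} = {}"
    then have U: "UNIV = {\<theta>}" by auto
    have "x $ \<theta> = 1"
      using assms(1) by (simp add: belief_simplex_def U)
    then have "x = vertex \<theta>"
      using U by (simp add: vec_eq_iff axis_def) (metis UNIV_I singletonD)
    with assms(2) show False by simp
  qed
  then have "minD H x \<le> Min ((\<lambda>\<theta>'. divergence H (vertex \<theta>') x) ` (UNIV - {\<theta>}))"
    unfolding minD_def by (intro Min_antimono) auto
  with lt assms(3) show False
    by (auto simp: argminD_def)
qed

lemma argminD_subset: "x \<in> open_face F \<Longrightarrow> argminD H x \<subseteq> F"
proof
  fix \<theta> assume x: "x \<in> open_face F" and \<theta>: "\<theta> \<in> argminD H x"
  then have "eps < x $ \<theta>"
    using open_face_subset[of F] by (intro argminD_above not_vertex) auto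
  then show "\<theta> \<in> F"
    using x eps by (auto simp: open_face_def intro: less_trans)
qed

text \<open>Minimisers lie in \<open>F\<close>, so the minimum over all states is attained there and
  the comparison can be confined to the real values \<open>D\<close>.\<close>

lemma argminD_iff:
  assumes x: "x \<in> open_face F"
  shows "\<theta> \<in> argminD H x \<longleftrightarrow> \<theta> \<in> F \<and> (\<forall>\<theta>'\<in>F. D \<theta> x \<le> D \<theta>' x)"
proof -
  obtain \<theta>0 where \<theta>0: "\<theta>0 \<in> argminD H x"
    using argminD_nonempty by blast
  have \<theta>0F: "\<theta>0 \<in> F" using argminD_subset[OF x] \<theta>0 by blast
  have min: "minD H x = ereal (D \<theta>0 x)"
    using divergence_eq[OF x \<theta>0F] \<theta>0 by (simp add: argminD_def)
  have le: "D \<theta>0 x \<le> D \<theta>' x" if "\<theta>' \<in> F" for \<theta>'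
    using minD_le[of x \<theta>'] divergence_eq[OF x that] min by simp
  show ?thesis
  proof (intro iffI conjI)
    assume \<theta>: "\<theta> \<in> argminD H x"
    then show \<theta>F: "\<theta> \<in> F" using argminD_subset[OF x] by blast
    then show "\<forall>\<theta>'\<in>F. D \<theta> x \<le> D \<theta>' x"
      using le divergence_eq[OF x \<theta>F] \<theta> min by (simp add: argminD_def)
  next
    assume "\<theta> \<in> F \<and> (\<forall>\<theta>'\<in>F. D \<theta> x \<le> D \<theta>' x)"
    then have "divergence H (vertex \<theta>) x = minD H x"
      using le \<theta>0F divergence_eq[OF x] min by (simp add: order_antisym)
    then show "\<theta> \<in> argminD H x" by (simp add: argminD_def)
  qed
qed

lemma zeta_eq:
  assumes "muhat t \<in> open_face F" "\<theta> \<in> argminD H (muhat t)"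
  shows "\<zeta> t = D \<theta> (muhat t)" and "minD H (muhat t) = ereal (\<zeta> t)"
proof -
  have "\<theta> \<in> F" using argminD_subset assms by blast
  then have "minD H (muhat t) = ereal (D \<theta> (muhat t))"
    using divergence_eq assms by (auto simp: argminD_def)
  then show "\<zeta> t = D \<theta> (muhat t)" "minD H (muhat t) = ereal (\<zeta> t)"
    by (auto simp: zeta_def)
qed

lemma zeta_pos: "muhat t \<in> open_face F \<Longrightarrow> 0 < \<zeta> t"
  using argminD_nonempty[of "muhat t"] zeta_eq(1)[of t] D_pos[of "muhat t"] argminD_subset[of "muhat t"]
  by (metis ex_in_conv subsetD)

text \<open>The first-order term of \<open>H\<close> cancels against the one coming from the moving
  base point in \<open>vertex \<theta> - x\<close>, so only the second derivative remains.\<close>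

lemma D_derivative:
  assumes "x \<in> open_face F"
  shows "(D \<theta> has_derivative (\<lambda>v. - ((h x *v v) \<bullet> (vertex \<theta> - x)))) (at x within open_face F)"
proof -
  have "((\<lambda>x. H (vertex \<theta>) - H x - g x \<bullet> (vertex \<theta> - x)) has_derivative
      (\<lambda>v. 0 - g x \<bullet> v - (g x \<bullet> (0 - v) + (h x *v v) \<bullet> (vertex \<theta> - x)))) (at x within open_face F)"
    by (intro has_derivative_diff has_derivative_inner has_derivative_const has_derivative_ident
        H_derivative[OF assms] g_derivative[OF assms])
  then show ?thesis
    by (simp add: D_def[abs_def])
qed

lemma continuous_on_D: "continuous_on (open_face F) (D \<theta>)"
  by (rule has_derivative_continuous_on[OF D_derivative])

section \<open>The clauses of the greedy path, one by one\<close>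

lemmas path_conjuncts = path[unfolded greedy_path_def]

lemma start_0: "start 0 = 0"
  by (rule path_conjuncts[THEN conjunct1])

lemma continuous_muhat: "continuous_on {0..} muhat"
  by (rule path_conjuncts[THEN conjunct2, THEN conjunct2, THEN conjunct1])

lemma muhat_belief: "0 \<le> t \<Longrightarrow> muhat t \<in> belief_simplex"
  by (rule path_conjuncts[THEN conjunct2, THEN conjunct2, THEN conjunct2, THEN conjunct1, rule_format])

lemma rate_nonneg: "0 \<le> t \<Longrightarrow> 0 \<le> \<beta> t \<theta>"
  by (rule path_conjuncts[THEN conjunct2, THEN conjunct2, THEN conjunct2, THEN conjunct2,
        THEN conjunct1, rule_format])

lemma active_start: "start k < \<infinity> \<Longrightarrow> A k = argminD H (muhat (real_of_ereal (start k)))"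
  by (rule path_conjuncts[THEN conjunct2, THEN conjunct2, THEN conjunct2, THEN conjunct2,
        THEN conjunct2, THEN conjunct1, rule_format])

lemmas path_stage = path_conjuncts[THEN conjunct2, THEN conjunct2, THEN conjunct2, THEN conjunct2,
        THEN conjunct2, THEN conjunct2, THEN conjunct1, THEN spec, THEN mp, OF conjI]

lemmas path_last = path_conjuncts[THEN conjunct2, THEN conjunct2, THEN conjunct2, THEN conjunct2,
        THEN conjunct2, THEN conjunct2, THEN conjunct2, THEN spec, THEN mp, OF conjI]

lemma
  assumes k: "start k < \<infinity>" "A k \<noteq> UNIV"
  shows entry: "if entry_times H start A muhat k = {} then start (Suc k) = \<infinity>
         else start (Suc k) \<in> entry_times H start A muhat k \<and>
              (\<forall>s\<in>entry_times H start A muhat k. start (Suc k) \<le> s)"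
    and equal_divergence: "t \<in> stage start k \<Longrightarrow> \<theta> \<in> A k \<Longrightarrow> \<theta>' \<in> A k \<Longrightarrow>
           divergence H (vertex \<theta>) (muhat t) = divergence H (vertex \<theta>') (muhat t)"
    and throughput: "t \<in> stage start k \<Longrightarrow>
           (\<Sum>\<theta>\<in>A k. ereal (\<beta> t \<theta>) * divergence H (vertex \<theta>) (muhat t)) = ereal chi"
    and inactive: "t \<in> stage start k \<Longrightarrow> \<theta> \<notin> A k \<Longrightarrow> \<beta> t \<theta> = 0"
    and velocity: "t \<in> stage start k \<Longrightarrow>
           (muhat has_vector_derivative - (\<Sum>\<theta>\<in>A k. \<beta> t \<theta> *\<^sub>R (vertex \<theta> - muhat t)))
             (at t within stage start k)"
proof -
  note * = path_stage[OF k]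
  note t = *[THEN conjunct1, THEN bspec]
  show "if entry_times H start A muhat k = {} then start (Suc k) = \<infinity>
         else start (Suc k) \<in> entry_times H start A muhat k \<and>
              (\<forall>s\<in>entry_times H start A muhat k. start (Suc k) \<le> s)"
    by (rule *[THEN conjunct2])
  show "divergence H (vertex \<theta>) (muhat t) = divergence H (vertex \<theta>') (muhat t)"
    if "t \<in> stage start k" "\<theta> \<in> A k" "\<theta>' \<in> A k"
    by (rule t[OF that(1), THEN conjunct1, rule_format, OF that(2,3)])
  show "(\<Sum>\<theta>\<in>A k. ereal (\<beta> t \<theta>) * divergence H (vertex \<theta>) (muhat t)) = ereal chi"
    if "t \<in> stage start k"
    by (rule t[OF that, THEN conjunct2, THEN conjunct1])
  show "\<beta> t \<theta> = 0" if "t \<in> stage start k" "\<theta> \<notin> A k"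
    by (rule t[OF that(1), THEN conjunct2, THEN conjunct2, THEN conjunct1, rule_format, OF that(2)])
  show "(muhat has_vector_derivative - (\<Sum>\<theta>\<in>A k. \<beta> t \<theta> *\<^sub>R (vertex \<theta> - muhat t)))
             (at t within stage start k)" if "t \<in> stage start k"
    by (rule t[OF that, THEN conjunct2, THEN conjunct2, THEN conjunct2])
qed

lemma
  assumes k: "start k < \<infinity>" "A k = UNIV"
  shows last_stage: "start (Suc k) = \<infinity>"
    and last_path: "t \<in> stage start k \<Longrightarrow> muhat t = muhat (real_of_ereal (start k))"
    and last_rate: "t \<in> stage start k \<Longrightarrow>
        \<beta> t \<theta> = chi / real_of_ereal (divergence H (vertex \<theta>) (muhat t)) * muhat t $ \<theta>"
proof -
  note * = path_last[OF k]
  note t = *[THEN conjunct2, THEN bspec]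
  show "start (Suc k) = \<infinity>"
    by (rule *[THEN conjunct1])
  show "muhat t = muhat (real_of_ereal (start k))" if "t \<in> stage start k"
    by (rule t[OF that, THEN conjunct1])
  show "\<beta> t \<theta> = chi / real_of_ereal (divergence H (vertex \<theta>) (muhat t)) * muhat t $ \<theta>"
    if "t \<in> stage start k"
    by (rule t[OF that, THEN conjunct2, THEN spec])
qed

section \<open>Evolution of belief, active set and divergence within one stage\<close>

lemma argminD_in_stage:
  assumes "start k < \<infinity>" "A k \<noteq> UNIV" "t \<in> stage start k"
  shows "argminD H (muhat t) = A k"
proof -
  have sub: "argminD H (muhat t) \<subseteq> A k"
  proof (rule ccontr)
    assume "\<not> ?thesis"
    then have "ereal t \<in> entry_times H start A muhat k"
      using assms(3) by (auto simp: entry_times_def stage_def)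
    then have "start (Suc k) \<le> ereal t"
      using entry[OF assms(1,2)] by (auto split: if_splits)
    then show False using assms(3) by (auto simp: stage_def)
  qed
  \<comment> \<open>Some active state attains the minimum; since active states have equal
    divergence, all of them do.\<close>
  obtain \<theta> where \<theta>: "\<theta> \<in> argminD H (muhat t)"
    using argminD_nonempty by blast
  then have "\<theta>' \<in> argminD H (muhat t)" if "\<theta>' \<in> A k" for \<theta>'
    using equal_divergence[OF assms(1,2,3) that, of \<theta>] sub by (auto simp: argminD_def)
  with sub show ?thesis by blast
qed

text \<open>A minimiser at time \<open>s\<close> itself is already in \<open>A k\<close>, so no
  entry can happen at \<open>s\<close> and every stage has positive length.\<close>

lemma stage_next:
  assumes "start k = ereal s" "0 \<le> s"
  shows "ereal s < start (Suc k)"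
proof (cases "A k = UNIV")
  case True
  then show ?thesis using last_stage[of k] assms by simp
next
  case False
  have k: "start k < \<infinity>" using assms by simp
  show ?thesis
  proof (cases "entry_times H start A muhat k = {}")
    case True
    then show ?thesis using entry[OF k False] by simp
  next
    case ne: False
    have "start (Suc k) \<in> entry_times H start A muhat k"
      using entry[OF k False] ne by simp
    then obtain u where u: "start (Suc k) = ereal u" "start k \<le> ereal u"
        "\<not> argminD H (muhat u) \<subseteq> A k"
      by (auto simp: entry_times_def)
    then have "u \<noteq> s"
      using active_start[OF k] assms by auto
    then show ?thesis using u assms by simp
  qed
qed

lemma stage_iff:
  assumes "start k = ereal s"
  shows "t \<in> stage start k \<longleftrightarrow> s \<le> t \<and> ereal t < start (Suc k)"
  by (simp add: stage_def assms)

text \<open>None of the active vertices has a component at an inactive \<open>\<theta>\<close>, so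
  that belief is only pushed up, at the relative rate \<open>total_rate\<close>.\<close>

lemma velocity_component:
  assumes k: "start k < \<infinity>" "A k \<noteq> UNIV" "t \<in> stage start k" and \<theta>: "\<theta> \<notin> A k"
  shows "((\<lambda>t. muhat t $ \<theta>) has_vector_derivative total_rate t * muhat t $ \<theta>) (at t within stage start k)"
proof -
  have "((\<lambda>t. muhat t $ \<theta>) has_vector_derivative (- (\<Sum>\<theta>'\<in>A k. \<beta> t \<theta>' *\<^sub>R (vertex \<theta>' - muhat t))) $ \<theta>)
      (at t within stage start k)"
    using bounded_linear.has_vector_derivative[OF bounded_linear_vec_nth velocity[OF k]] .
  also have "(- (\<Sum>\<theta>'\<in>A k. \<beta> t \<theta>' *\<^sub>R (vertex \<theta>' - muhat t))) $ \<theta> = (\<Sum>\<theta>'\<in>A k. \<beta> t \<theta>' * muhat t $ \<theta>)"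
    using \<theta> by (auto simp: sum_negf[symmetric] axis_def intro!: sum.cong)
  also have "\<dots> = total_rate t * muhat t $ \<theta>"
    unfolding total_rate_def sum_distrib_right
    using inactive[OF k] by (intro sum.mono_neutral_left) auto
  finally show ?thesis .
qed

lemma total_rate_nonneg: "0 \<le> t \<Longrightarrow> 0 \<le> total_rate t"
  by (simp add: total_rate_def sum_nonneg rate_nonneg)

lemma total_rate_integrable: "0 \<le> s \<Longrightarrow> s \<le> t \<Longrightarrow> total_rate integrable_on {s..t}"
  unfolding total_rate_def by (intro integrable_sum rates_integrable) auto

text \<open>Active coordinates exceed \<open>eps\<close> because rare states cannot be minimisers,
  inactive ones have a nonnegative derivative, and those off \<open>F\<close> solve a homogeneous
  linear equation started at \<open>0\<close>. The lower bounds do not depend on \<open>t\<close>,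
  so they survive at the end of the stage.\<close>

lemma stage_on_face:
  assumes s: "start k = ereal s" "0 \<le> s" and face: "muhat s \<in> open_face F" and nU: "A k \<noteq> UNIV"
    and t: "s \<le> t" "ereal t < start (Suc k)"
  shows "\<theta> \<in> A k \<Longrightarrow> eps \<le> muhat t $ \<theta>"
    and "\<theta> \<notin> A k \<Longrightarrow> muhat s $ \<theta> \<le> muhat t $ \<theta>"
    and "\<theta> \<notin> F \<Longrightarrow> muhat t $ \<theta> = 0"
    and "muhat t \<in> open_face F"
proof -
  have k: "start k < \<infinity>" using s by simp
  have AF: "A k \<subseteq> F"
    using active_start[OF k] argminD_subset[OF face] s by simp
  have st: "u \<in> stage start k" if "u \<in> {s..t}" for u
    unfolding stage_iff[OF s(1)] using t that by (auto intro: le_less_trans[of _ "ereal t"])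
  have sub: "{s..t} \<subseteq> stage start k" using st by blast
  have bel: "muhat u \<in> belief_simplex" if "u \<in> {s..t}" for u
    using muhat_belief s that by auto
  have der: "((\<lambda>t. muhat t $ \<theta>) has_vector_derivative total_rate u * muhat u $ \<theta>) (at u within {s..t})"
    if "u \<in> {s..t}" "\<theta> \<notin> A k" for u \<theta>
    using has_vector_derivative_within_subset[OF velocity_component[OF k nU st[OF that(1)] that(2)] sub] .
  have nn: "0 \<le> muhat u $ \<theta>" if "u \<in> {s..t}" for u \<theta>
    using bel[OF that] by (simp add: belief_simplex_def)
  have up: "muhat s $ \<theta> \<le> muhat t $ \<theta>" if "\<theta> \<notin> A k" for \<theta>
  proof -
    have "((\<lambda>u. total_rate u * muhat u $ \<theta>) has_integral (muhat t $ \<theta> - muhat s $ \<theta>)) {s..t}"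
      using t(1) der that by (intro fundamental_theorem_of_calculus) auto
    then have "0 \<le> muhat t $ \<theta> - muhat s $ \<theta>"
      by (rule has_integral_nonneg) (use nn total_rate_nonneg s in auto)
    then show ?thesis by simp
  qed
  then show "\<theta> \<notin> A k \<Longrightarrow> muhat s $ \<theta> \<le> muhat t $ \<theta>" by blast
  have zero: "muhat t $ \<theta> = 0" if "\<theta> \<notin> F" for \<theta>
  proof (rule linear_ode_zero[of s t "\<lambda>t. muhat t $ \<theta>" total_rate])
    show "total_rate integrable_on {s..t}"
      using s t by (intro total_rate_integrable)
    show "muhat s $ \<theta> = 0"
      using face that by (auto simp: open_face_def belief_simplex_def order.order_iff_strict)
  qed (use der that AF total_rate_nonneg s nn t in auto)
  then show "\<theta> \<notin> F \<Longrightarrow> muhat t $ \<theta> = 0" by blast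
  \<comment> \<open>The bound by \<open>eps\<close> needs \<open>muhat t\<close> off the vertices.
    At an active vertex all active divergences would vanish, contradicting positive throughput; at
    an inactive one some other state would be a minimiser although its belief is
    \<open>0\<close>.\<close>
  have nv: "muhat t \<noteq> vertex \<theta>" if "\<theta> \<in> F" for \<theta>
  proof
    assume v: "muhat t = vertex \<theta>"
    have "slope (hext H) (vertex \<theta>) 0 = 0"
      unfolding slope_def by (intro tendsto_Lim) (auto simp: zero_ereal_def)
    then have dv: "divergence H (vertex \<theta>) (muhat t) = 0"
      by (simp add: v divergence_def bregman_def zero_ereal_def)
    show False
    proof (cases "\<theta> \<in> A k")
      case True
      then have "divergence H (vertex \<theta>') (muhat t) = 0" if "\<theta>' \<in> A k" for \<theta>'
        using equal_divergence[OF k nU st[of t] that True] dv t(1) by simp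
      then have "(\<Sum>\<theta>'\<in>A k. ereal (\<beta> t \<theta>') * divergence H (vertex \<theta>') (muhat t)) = 0"
        by (intro sum.neutral) auto
      then show False
        using throughput[OF k nU st[of t]] chi t(1) by (simp add: zero_ereal_def)
    next
      case False
      obtain \<theta>' where \<theta>': "\<theta>' \<in> A k"
        using argminD_nonempty active_start[OF k] by blast
      then have "\<theta>' \<in> argminD H (muhat t)" "\<theta>' \<noteq> \<theta>"
        using argminD_in_stage[OF k nU st[of t]] t(1) False by auto
      moreover have "muhat t \<noteq> vertex \<theta>'"
        using v \<open>\<theta>' \<noteq> \<theta>\<close> by (simp add: axis_eq_axis)
      ultimately have "eps < muhat t $ \<theta>'"
        using bel[of t] t(1) by (intro argminD_above) auto
      then show False
        using v eps \<open>\<theta>' \<noteq> \<theta>\<close> by (simp add: axis_def)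
    qed
  qed
  have above: "eps < muhat t $ \<theta>" if "\<theta> \<in> A k" for \<theta>
  proof (rule argminD_above)
    show "muhat t \<in> belief_simplex" using bel t by simp
    show "muhat t \<noteq> vertex \<theta>" using nv that AF by blast
    show "\<theta> \<in> argminD H (muhat t)" 
      using argminD_in_stage[OF k nU st[of t]] that t(1) by simp
  qed
  then show "\<theta> \<in> A k \<Longrightarrow> eps \<le> muhat t $ \<theta>" by (auto intro: less_imp_le)
  have "0 < muhat t $ \<theta>" if "\<theta> \<in> F" for \<theta>
  proof (cases "\<theta> \<in> A k")
    case True then show ?thesis using above eps by (auto intro: less_trans)
  next
    case False
    moreover have "0 < muhat s $ \<theta>" using face that by (simp add: open_face_def)
    ultimately show ?thesis using up by (auto intro: less_le_trans)
  qed
  with zero have "0 < muhat t $ \<theta> \<longleftrightarrow> \<theta> \<in> F" for \<theta>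
    by (cases "\<theta> \<in> F") auto
  then show "muhat t \<in> open_face F"
    using bel[of t] t(1) by (simp add: open_face_def)
qed

text \<open>At the closing time positivity follows from the fixed lower bounds \<open>eps\<close>
  and \<open>muhat s $ \<theta>\<close>, and coordinates off \<open>F\<close> vanish by
  continuity.\<close>

lemma stage_end_on_face:
  assumes s: "start k = ereal s" "0 \<le> s" and face: "muhat s \<in> open_face F"
    and t: "s \<le> t" "ereal t \<le> start (Suc k)"
  shows "muhat t \<in> open_face F"
proof (cases "A k = UNIV")
  case True
  then have "start (Suc k) = \<infinity>" using last_stage[of k] s by simp
  then have "t \<in> stage start k" using t by (simp add: stage_iff[OF s(1)])
  then show ?thesis using last_path[of k t] True s face by simp
next
  case nU: False
  note on = stage_on_face[OF s face nU]
  show ?thesis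
  proof (cases "ereal t < start (Suc k)")
    case True then show ?thesis using on(4) t by blast
  next
    case False
    then have fin: "start (Suc k) = ereal t" using t by simp
    then have st: "s < t" using stage_next[OF s] by simp
    have before: "ereal u < start (Suc k)" if "u < t" for u using that fin by simp
    have "continuous_on {s..t} muhat"
      by (rule continuous_on_subset[OF continuous_muhat]) (use s in auto)
    then have cont: "continuous_on {s..t} (\<lambda>u. muhat u $ \<theta>)" 
      and cont': "continuous_on {s..t} (\<lambda>u. - (muhat u $ \<theta>))" for \<theta>
      by (intro continuous_intros; assumption)+
    have bel: "muhat t \<in> belief_simplex" using muhat_belief s t by simp
    have zero: "muhat t $ \<theta> = 0" if "\<theta> \<notin> F" for \<theta>
    proof -
      have "0 \<le> - (muhat t $ \<theta>)"
        by (rule lowerbound_at_right_endpoint[OF cont' st]) (simp add: on(3) that before)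
      moreover have "0 \<le> muhat t $ \<theta>" using bel by (simp add: belief_simplex_def)
      ultimately show ?thesis by simp
    qed
    moreover have "0 < muhat t $ \<theta>" if "\<theta> \<in> F" for \<theta>
    proof (cases "\<theta> \<in> A k")
      case True
      have "eps \<le> muhat t $ \<theta>"
        by (rule lowerbound_at_right_endpoint[OF cont st]) (simp add: on(1) True before)
      then show ?thesis using eps by simp
    next
      case False
      have "muhat s $ \<theta> \<le> muhat t $ \<theta>"
        by (rule lowerbound_at_right_endpoint[OF cont st]) (simp add: on(2) False before)
      moreover have "0 < muhat s $ \<theta>" using face that by (simp add: open_face_def)
      ultimately show ?thesis by simp
    qed
    ultimately have "0 < muhat t $ \<theta> \<longleftrightarrow> \<theta> \<in> F" for \<theta>
      by (cases "\<theta> \<in> F") auto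
    then show ?thesis using bel by (simp add: open_face_def)
  qed
qed

text \<open>The entry time brings a minimiser outside \<open>A k\<close>. No old one is lost,
  because the inequalities between the continuous functions \<open>D\<close> hold before the closing
  time and pass to the limit.\<close>

lemma active_increasing:
  assumes s: "start k = ereal s" "0 \<le> s" and face: "muhat s \<in> open_face F"
    and e: "start (Suc k) = ereal t"
  shows "A k \<subset> A (Suc k)"
proof -
  have k: "start k < \<infinity>" and k': "start (Suc k) < \<infinity>" using s e by simp_all
  have nU: "A k \<noteq> UNIV" using last_stage[OF k] e by auto
  have st: "s < t" using stage_next[OF s] e by simp
  have face': "muhat u \<in> open_face F" if "u \<in> {s..t}" for u
    using stage_end_on_face[OF s face, of u] that e by simp
  have A': "A (Suc k) = argminD H (muhat t)"
    using active_start[OF k'] e by simp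
  have "entry_times H start A muhat k \<noteq> {}" using entry[OF k nU] e by auto
  then have "start (Suc k) \<in> entry_times H start A muhat k"
    using entry[OF k nU] by simp
  then have "\<not> A (Suc k) \<subseteq> A k"
    using e A' by (auto simp: entry_times_def)
  moreover have "\<theta> \<in> A (Suc k)" if \<theta>: "\<theta> \<in> A k" for \<theta>
    unfolding A' argminD_iff[OF face'[OF atLeastAtMost_iff[THEN iffD2, OF conjI[OF less_imp_le[OF st] order_refl]]]]
  proof (intro conjI ballI)
    have arg: "\<theta> \<in> argminD H (muhat u)" if "s \<le> u" "u < t" for u
      using argminD_in_stage[OF k nU, of u] \<theta> that e by (simp add: stage_iff[OF s(1)])
    then show "\<theta> \<in> F"
      using argminD_iff[OF face'[of s]] st by auto
    fix \<theta>' assume \<theta>': "\<theta>' \<in> F"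
    have "continuous_on {s..t} (\<lambda>u. D \<theta>' (muhat u) - D \<theta> (muhat u))"
      using continuous_muhat s face'
      by (intro continuous_intros continuous_on_compose2[OF continuous_on_D]) 
         (auto elim: continuous_on_subset)
    then have "0 \<le> D \<theta>' (muhat t) - D \<theta> (muhat t)"
    proof (rule lowerbound_at_right_endpoint[OF _ st])
      fix u assume "s \<le> u" "u < t"
      then show "0 \<le> D \<theta>' (muhat u) - D \<theta> (muhat u)"
        using arg[of u] argminD_iff[OF face'[of u]] \<theta>' by auto
    qed
    then show "D \<theta> (muhat t) \<le> D \<theta>' (muhat t)" by simp
  qed
  ultimately show ?thesis by blast
qed

text \<open>Before the last stage this is the throughput constraint divided by the common
  divergence. In the last stage the rates are \<open>chi / \<zeta> t\<close> times the beliefs,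
  which sum to \<open>1\<close>.\<close>

lemma stage_rate:
  assumes s: "start k = ereal s" "0 \<le> s" and face: "muhat s \<in> open_face F"
    and t: "s \<le> t" "ereal t < start (Suc k)"
  shows "total_rate t = chi / \<zeta> t"
proof -
  have k: "start k < \<infinity>" using s by simp
  have st: "t \<in> stage start k" using t by (simp add: stage_iff[OF s(1)])
  have face': "muhat t \<in> open_face F"
    using stage_end_on_face[OF s face t(1)] t by simp
  show ?thesis
  proof (cases "A k = UNIV")
    case True
    have arg: "\<theta> \<in> argminD H (muhat t)" for \<theta>
      using active_start[OF k] last_path[OF k True st] True by simp
    have "divergence H (vertex \<theta>) (muhat t) = ereal (\<zeta> t)" for \<theta>
      using zeta_eq(2)[OF face' arg] arg[of \<theta>] by (simp add: argminD_def)
    then have "\<beta> t \<theta> = chi / \<zeta> t * muhat t $ \<theta>" for \<theta>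
      using last_rate[OF k True st, of \<theta>] by simp
    then have "total_rate t = chi / \<zeta> t * (\<Sum>\<theta>\<in>UNIV. muhat t $ \<theta>)"
      by (simp add: total_rate_def sum_distrib_left)
    then show ?thesis
      using face' by (simp add: open_face_def belief_simplex_def)
  next
    case nU: False
    have arg: "argminD H (muhat t) = A k" by (rule argminD_in_stage[OF k nU st])
    have "divergence H (vertex \<theta>) (muhat t) = ereal (\<zeta> t)" if "\<theta> \<in> A k" for \<theta>
    proof -
      have \<theta>: "\<theta> \<in> argminD H (muhat t)" using that arg by simp
      then show ?thesis using zeta_eq(2)[OF face' \<theta>] by (simp add: argminD_def)
    qed
    then have "(\<Sum>\<theta>\<in>A k. ereal (\<beta> t \<theta>) * ereal (\<zeta> t)) = ereal chi"
      using throughput[OF k nU st] by simp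
    then have "(\<Sum>\<theta>\<in>A k. \<beta> t \<theta>) * \<zeta> t = chi"
      by (simp add: sum_distrib_right)
    moreover have "total_rate t = (\<Sum>\<theta>\<in>A k. \<beta> t \<theta>)"
      unfolding total_rate_def using inactive[OF k nU st] by (intro sum.mono_neutral_right) auto
    ultimately show ?thesis
      using zeta_pos[OF face'] by (simp add: eq_divide_eq)
  qed
qed

lemma stage_zeta_mono:
  assumes s: "start k = ereal s" "0 \<le> s" and face: "muhat s \<in> open_face F"
    and ab: "s \<le> a" "a \<le> b" "ereal b \<le> start (Suc k)"
  shows "\<zeta> a \<le> \<zeta> b"
proof (cases "A k = UNIV")
  case True
  have k: "start k < \<infinity>" using s by simp
  have "t \<in> stage start k" if "s \<le> t" for t
    using last_stage[OF k True] that by (simp add: stage_iff[OF s(1)])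
  then have "muhat a = muhat b"
    using last_path[OF k True] ab by (metis order_trans)
  then show ?thesis by (simp add: zeta_def)
next
  case nU: False
  have k: "start k < \<infinity>" using s by simp
  have face': "muhat t \<in> open_face F" if "t \<in> {s..b}" for t
    using stage_end_on_face[OF s face, of t] that order_trans[of "ereal t" "ereal b", OF _ ab(3)] by auto
  have in_stage: "t \<in> stage start k" if "t \<in> {s..<b}" for t
    using ab that by (auto simp: stage_iff[OF s(1)] intro: less_le_trans[of _ "ereal b"])
  obtain \<theta> where \<theta>: "\<theta> \<in> A k"
    using argminD_nonempty active_start[OF k] by blast
  \<comment> \<open>The closing time of the stage is included: active sets grow, so the old active
    states are still minimisers there.\<close>
  have arg: "\<theta> \<in> argminD H (muhat t)" if "\<theta> \<in> A k" "t \<in> {s..b}" for \<theta> t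
  proof (cases "ereal t < start (Suc k)")
    case True
    then show ?thesis using argminD_in_stage[OF k nU, of t] that by (simp add: stage_iff[OF s(1)])
  next
    case False
    moreover have "ereal t \<le> start (Suc k)"
      using that ab(3) by (auto intro: order_trans[of _ "ereal b"])
    ultimately have fin: "start (Suc k) = ereal t" by simp
    then have "A (Suc k) = argminD H (muhat t)"
      using active_start[of "Suc k"] by simp
    then show ?thesis using active_increasing[OF s face fin] that by blast
  qed
  have eq: "\<zeta> t = D \<theta> (muhat t)" if "\<theta> \<in> A k" "t \<in> {s..b}" for \<theta> t
    using zeta_eq(1)[OF face' arg] that by blast
  have "continuous_on {s..b} muhat"
    by (rule continuous_on_subset[OF continuous_muhat]) (use s in auto)
  then have "continuous_on {s..b} (\<lambda>t. D \<theta> (muhat t))"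
    using face' by (intro continuous_on_compose2[OF continuous_on_D]) auto
  then have cont: "continuous_on {a..b} \<zeta>"
    using ab(1) eq[OF \<theta>] by (subst continuous_on_cong[OF refl, of _ _ "\<lambda>t. D \<theta> (muhat t)"])
      (auto elim: continuous_on_subset)
  show ?thesis
  proof (rule DERIV_nonneg_imp_increasing_open[OF ab(2) _ cont])
    fix t assume t: "a < t" "t < b"
    define v where "v = - (\<Sum>\<theta>\<in>A k. \<beta> t \<theta> *\<^sub>R (vertex \<theta> - muhat t))"
    have st: "t \<in> stage start k" and ft: "muhat t \<in> open_face F" 
      using in_stage[of t] face'[of t] t ab by auto
    \<comment> \<open>On an open interval the derivative relative to the stage becomes two-sided;
      the end points are covered by continuity of \<open>\<zeta>\<close>.\<close>
    have sub: "{s<..<b} \<subseteq> stage start k" using in_stage by auto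
    have vd: "(muhat has_derivative (\<lambda>x. x *\<^sub>R v)) (at t within {s<..<b})"
      using has_vector_derivative_within_subset[OF velocity[OF k nU st] sub]
      by (simp add: has_vector_derivative_def v_def)
    have dD: "(\<zeta> has_real_derivative - ((h (muhat t) *v v) \<bullet> (vertex \<theta> - muhat t))) (at t)"
      if \<theta>: "\<theta> \<in> A k" for \<theta>
    proof -
      have "(D \<theta> has_derivative (\<lambda>v. - ((h (muhat t) *v v) \<bullet> (vertex \<theta> - muhat t))))
          (at (muhat t) within muhat ` {s<..<b})"
        using face' by (intro has_derivative_subset[OF D_derivative[OF ft]]) auto
      from diff_chain_within[OF vd this]
      have "((\<lambda>u. D \<theta> (muhat u)) has_derivative
          (\<lambda>x. - ((h (muhat t) *v v) \<bullet> (vertex \<theta> - muhat t)) * x)) (at t within {s<..<b})"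
        by (simp add: o_def matrix_vector_mult_scaleR mult.commute)
      then have "((\<lambda>u. D \<theta> (muhat u)) has_real_derivative - ((h (muhat t) *v v) \<bullet> (vertex \<theta> - muhat t)))
          (at t within {s<..<b})"
        by (simp only: has_field_derivative_def)
      then have "((\<lambda>u. D \<theta> (muhat u)) has_real_derivative - ((h (muhat t) *v v) \<bullet> (vertex \<theta> - muhat t))) (at t)"
        using t ab at_within_open[of t "{s<..<b}"] by simp
      then show ?thesis
        by (rule has_field_derivative_transform_within_open[of _ _ _ "{s<..<b}"])
           (use t ab eq[OF \<theta>] in auto)
    qed
    let ?d = "- ((h (muhat t) *v v) \<bullet> (vertex \<theta> - muhat t))"
    \<comment> \<open>Every active \<open>D\<close> coincides with \<open>\<zeta>\<close> along the
      path, so these expressions are all the derivative of \<open>\<zeta>\<close> at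
      \<open>t\<close>.\<close>
    have same: "- ((h (muhat t) *v v) \<bullet> (vertex \<theta>' - muhat t)) = ?d" if "\<theta>' \<in> A k" for \<theta>'
      using DERIV_unique[OF dD[OF that] dD[OF \<theta>]] .
    have AF: "A k \<subseteq> F"
      using active_start[OF k] argminD_subset[OF face] s by simp
    \<comment> \<open>Only the second factor \<open>v\<close> is expanded; the quadratic form
      becomes the sum of the derivatives of the active divergences, weighted by the rates.\<close>
    have "(h (muhat t) *v v) \<bullet> v = (\<Sum>\<theta>'\<in>A k. \<beta> t \<theta>' * - ((h (muhat t) *v v) \<bullet> (vertex \<theta>' - muhat t)))"
      by (subst (2) v_def) (simp add: inner_sum_right sum_negf)
    also have "\<dots> = (\<Sum>\<theta>'\<in>A k. \<beta> t \<theta>') * ?d"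
      unfolding sum_distrib_right by (intro sum.cong refl arg_cong2[where f="(*)"] same)
    also have "(\<Sum>\<theta>'\<in>A k. \<beta> t \<theta>') = total_rate t"
      unfolding total_rate_def using inactive[OF k nU st] by (intro sum.mono_neutral_left) auto
    finally have "total_rate t * ?d = (h (muhat t) *v v) \<bullet> v" by simp
    also have "\<dots> \<ge> 0"
    proof (rule strictly_convex_on_Hess_nonneg[OF conv ft _ _ H_derivative g_derivative[OF ft]])
      show "(\<Sum>i\<in>UNIV. v $ i) = 0"
      proof -
        have "(\<Sum>i\<in>UNIV. v $ i) = - (\<Sum>\<theta>\<in>A k. \<beta> t \<theta> * (\<Sum>i\<in>UNIV. (vertex \<theta> - muhat t) $ i))"
          unfolding v_def by (simp add: sum_distrib_left sum_negf) (subst sum.swap, rule refl)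
        also have "\<dots> = 0"
          using open_face_tangent(1)[OF ft] AF by (auto intro!: sum.neutral)
        finally show ?thesis .
      qed
      show "v $ i = 0" if "i \<notin> F" for i
        unfolding v_def using open_face_tangent(2)[OF ft _ that] AF
        by (auto intro!: sum.neutral)
    qed auto
    finally have "0 \<le> total_rate t * ?d" .
    moreover have "0 < total_rate t"
    proof -
      have "total_rate t = chi / \<zeta> t"
        using stage_rate[OF s face, of t] st by (simp add: stage_iff[OF s(1)])
      then show ?thesis using chi zeta_pos[OF ft] by simp
    qed
    ultimately have "0 \<le> ?d" by (subst (asm) zero_le_mult_iff) auto
    then show "\<exists>y. (\<zeta> has_real_derivative y) (at t) \<and> 0 \<le> y"
      using dD[OF \<theta>] by blast
  qed
qed

section \<open>Gluing the stages to the whole half-line\<close>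

lemma stage_starts:
  assumes "\<And>j. j \<le> k \<Longrightarrow> start j < \<infinity>"
  shows "\<exists>s\<ge>0. start k = ereal s \<and> (\<forall>t\<in>{0..s}. muhat t \<in> open_face F) \<and>
    (\<forall>t\<in>{0..<s}. total_rate t = chi / \<zeta> t) \<and> mono_on {0..s} \<zeta> \<and> k < card (A k)"
  using assms
proof (induction k)
  case 0
  have "A 0 \<noteq> {}"
    using active_start[of 0] argminD_nonempty start_0 by simp
  then have "0 < card (A 0)" by (simp add: card_gt_0_iff)
  then show ?case
    using start_0 muhat0(1) by (intro exI[of _ 0]) (auto simp: mono_on_def zero_ereal_def)
next
  case (Suc k)
  then obtain s where s: "0 \<le> s" "start k = ereal s" "\<And>t. t \<in> {0..s} \<Longrightarrow> muhat t \<in> open_face F"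
      "\<And>t. t \<in> {0..<s} \<Longrightarrow> total_rate t = chi / \<zeta> t" "mono_on {0..s} \<zeta>" "k < card (A k)"
    by auto
  have face: "muhat s \<in> open_face F" using s by simp
  obtain s' where s': "start (Suc k) = ereal s'"
    using Suc.prems[of "Suc k"] stage_next[OF s(2,1)] by (cases "start (Suc k)") auto
  have ss': "s < s'" using stage_next[OF s(2,1)] s' by simp
  \<comment> \<open>Strict growth of the active sets preserves \<open>k < card (A k)\<close>, the
    part of the invariant that limits the number of stages.\<close>
  have "card (A k) < card (A (Suc k))"
    using active_increasing[OF s(2,1) face s'] by (intro psubset_card_mono) auto
  then have "Suc k < card (A (Suc k))" using s by simp
  moreover have "muhat t \<in> open_face F" if "t \<in> {0..s'}" for t
    using s(3)[of t] stage_end_on_face[OF s(2,1) face, of t] that s' by (cases "t \<le> s") auto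
  moreover have "total_rate t = chi / \<zeta> t" if "t \<in> {0..<s'}" for t
    using s(4)[of t] stage_rate[OF s(2,1) face, of t] that s' by (cases "t < s") auto
  moreover have "mono_on {0..s'} \<zeta>"
  proof (rule mono_onI)
    fix a b assume ab: "a \<in> {0..s'}" "b \<in> {0..s'}" "a \<le> b"
    have below: "\<zeta> c \<le> \<zeta> d" if "0 \<le> c" "c \<le> d" "d \<le> s" for c d
      using s(5) that by (auto simp: mono_on_def)
    have above: "\<zeta> c \<le> \<zeta> d" if "s \<le> c" "c \<le> d" "d \<le> s'" for c d
      using stage_zeta_mono[OF s(2,1) face, of c d] that s' by simp
    show "\<zeta> a \<le> \<zeta> b"
    proof (cases "b \<le> s")
      case True then show ?thesis using below ab by auto
    next
      case b: False
      show ?thesis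
      proof (cases "s \<le> a")
        case True then show ?thesis using above ab by auto
      next
        case False
        then show ?thesis
          using below[of a s] above[of s b] ab b s(1) by auto
      qed
    qed
  qed
  ultimately show ?case
    using s' ss' s(1) by (intro exI[of _ s']) auto
qed

text \<open>If all starting times stayed below \<open>t\<close>, every stage would be reached and
  the invariant \<open>k < card (A k)\<close> would fail at \<open>k = CARD('n)\<close>.\<close>

lemma stage_exists:
  "\<exists>k. start k < \<infinity> \<and> (\<forall>j\<le>k. start j < \<infinity>) \<and> start k \<le> ereal t \<and> ereal t < start (Suc k)" if "0 \<le> t"
proof -
  have "\<exists>k. ereal t < start k"
  proof (rule ccontr)
    assume "\<not> ?thesis"
    then have "start j \<le> ereal t" for j
      by (simp add: not_less)
    then have "start j < \<infinity>" for j
      by (rule le_less_trans) simp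
    then have "k < card (A k)" for k
      using stage_starts[of k] by blast
    then have "CARD('n) < card (A CARD('n))" by blast
    then show False
      using card_mono[of UNIV "A CARD('n)"] by simp
  qed
  then obtain m where m: "ereal t < start m" "\<And>j. j < m \<Longrightarrow> \<not> ereal t < start j"
    using exists_least_iff[of "\<lambda>k. ereal t < start k"] by blast
  have "m \<noteq> 0"
  proof
    assume "m = 0"
    then show False using m(1) that start_0 by (simp add: zero_ereal_def)
  qed
  then obtain k where k: "m = Suc k" by (cases m) auto
  have "start j \<le> ereal t" if "j \<le> k" for j
    using m(2)[of j] that k by auto
  then have "start k \<le> ereal t" "\<forall>j\<le>k. start j < \<infinity>"
    using le_less_trans[of _ "ereal t" \<infinity>] by simp_all
  then show ?thesis using m(1) k by auto
qed

lemma
  assumes "0 \<le> t"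
  shows on_face: "muhat t \<in> open_face F" and hazard: "total_rate t = chi / \<zeta> t"
proof -
  obtain k where k: "\<forall>j\<le>k. start j < \<infinity>" "start k \<le> ereal t" "ereal t < start (Suc k)"
    using stage_exists[OF assms] by blast
  then obtain s where s: "0 \<le> s" "start k = ereal s" "\<forall>t\<in>{0..s}. muhat t \<in> open_face F"
    using stage_starts[of k] by auto
  then have "muhat s \<in> open_face F" by simp
  from stage_end_on_face[OF s(2,1) this, of t] stage_rate[OF s(2,1) this, of t]
  show "muhat t \<in> open_face F" "total_rate t = chi / \<zeta> t"
    using k s by auto
qed

lemma zeta_mono: "mono_on {0..} \<zeta>"
proof (rule mono_onI)
  fix a b :: real assume ab: "a \<in> {0..}" "b \<in> {0..}" "a \<le> b"
  obtain k where k: "\<forall>j\<le>k. start j < \<infinity>" "start k \<le> ereal b" "ereal b < start (Suc k)"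
    using stage_exists[of b] ab by auto
  then obtain s where s: "0 \<le> s" "start k = ereal s" "mono_on {0..s} \<zeta>"
    using stage_starts[of k] by auto
  have "muhat s \<in> open_face F" using on_face s by simp
  note m = stage_zeta_mono[OF s(2,1) this]
  show "\<zeta> a \<le> \<zeta> b"
  proof (cases "s \<le> a")
    case True then show ?thesis using m[of a b] ab k by simp
  next
    case False
    then have "\<zeta> a \<le> \<zeta> s" using s ab by (auto simp: mono_on_def)
    also have "\<zeta> s \<le> \<zeta> b" using m[of s b] k s by simp
    finally show ?thesis .
  qed
qed

text \<open>On the face \<open>\<zeta>\<close> is a minimum of finitely many functions that are
  continuous along the whole path, so changes of the active set cause no jumps.\<close>

lemma continuous_zeta: "continuous_on {0..} \<zeta>"
proof -
  have eq: "\<zeta> t = Min ((\<lambda>\<theta>. D \<theta> (muhat t)) ` F)" if t: "0 \<le> t" for t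
  proof -
    obtain \<theta> where \<theta>: "\<theta> \<in> argminD H (muhat t)" using argminD_nonempty by blast
    then have "\<theta> \<in> F" "\<forall>\<theta>'\<in>F. D \<theta> (muhat t) \<le> D \<theta>' (muhat t)"
      using argminD_iff[OF on_face[OF t]] by auto
    then have "Min ((\<lambda>\<theta>. D \<theta> (muhat t)) ` F) = D \<theta> (muhat t)"
      by (intro Min_eqI) auto
    then show ?thesis
      using zeta_eq(1)[OF on_face[OF t] \<theta>] by simp
  qed
  have F: "F \<noteq> {}"
    using argminD_iff[OF muhat0(1)] argminD_nonempty by blast
  have cont: "continuous_on {0..} (\<lambda>t. D \<theta> (muhat t))" for \<theta>
    using continuous_muhat on_face by (intro continuous_on_compose2[OF continuous_on_D]) auto
  have "continuous_on {0..} (\<lambda>t. Min ((\<lambda>\<theta>. D \<theta> (muhat t)) ` F))"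
    using finite[of F] F
  proof (induction F rule: finite_ne_induct)
    case (insert \<theta> F)
    then show ?case
      using cont by (simp add: continuous_on_min)
  qed (simp add: cont)
  then show ?thesis
    using eq by (subst continuous_on_cong[OF refl]) auto
qed

end

section \<open>The stopping time\<close>

text \<open>The increment law over \<open>{0..t}\<close> with count \<open>0\<close> gives each
  factor; independence of the trajectories gives the product, in which the exponents add up.\<close>

lemma independent_counters_no_arrival:
  fixes Q :: "'n::finite \<Rightarrow> real \<Rightarrow> 'w \<Rightarrow> nat"
  assumes M: "prob_space M" and Q: "independent_counters M \<beta> Q" and t: "0 \<le> t"
  shows "{\<omega>\<in>space M. \<forall>\<theta>. Q \<theta> t \<omega> = 0} \<in> sets M"
    and "measure M {\<omega>\<in>space M. \<forall>\<theta>. Q \<theta> t \<omega> = 0} = exp (- integral {0..t} (\<lambda>u. \<Sum>\<theta>\<in>UNIV. \<beta> u \<theta>))"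
proof -
  interpret prob_space M by fact
  have pc: "poisson_counter M (\<lambda>t. \<beta> t \<theta>) (Q \<theta>)" for \<theta>
    using Q by (simp add: independent_counters_def)
  have meas [measurable]: "Q \<theta> t \<in> measurable M (count_space UNIV)"
      "Q \<theta> 0 \<in> measurable M (count_space UNIV)" for \<theta>
    using pc[of \<theta>] t by (auto simp: poisson_counter_def)
  have Q0: "AE \<omega> in M. Q \<theta> 0 \<omega> = 0" for \<theta>
    using pc[of \<theta>] unfolding poisson_counter_def by (auto elim: AE_mp)
  have int: "(\<lambda>t. \<beta> t \<theta>) integrable_on {0..t}" for \<theta>
    using pc[of \<theta>] t by (auto simp: poisson_counter_def)
  have single: "prob {\<omega>\<in>space M. Q \<theta> t \<omega> = 0} = exp (- integral {0..t} (\<lambda>t. \<beta> t \<theta>))" for \<theta>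
  proof -
    have [measurable]: "(\<lambda>\<omega>. real (Q \<theta> t \<omega>)) \<in> borel_measurable M"
        "(\<lambda>\<omega>. real (Q \<theta> 0 \<omega>)) \<in> borel_measurable M"
      by (rule measurable_compose[OF meas(1)], simp) (rule measurable_compose[OF meas(2)], simp)
    \<comment> \<open>Subtraction on \<open>nat\<close> is truncated, so a zero increment means
      \<open>Q \<theta> t \<omega> \<le> Q \<theta> 0 \<omega>\<close>; in this form the event is
      visibly measurable.\<close>
    have "{\<omega>\<in>space M. real (Q \<theta> t \<omega>) \<le> real (Q \<theta> 0 \<omega>)} \<in> sets M"
      by measurable
    then have "prob {\<omega>\<in>space M. Q \<theta> t \<omega> = 0} = prob {\<omega>\<in>space M. Q \<theta> t \<omega> - Q \<theta> 0 \<omega> = 0}"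
      using Q0[of \<theta>] by (intro measure_eq_AE) auto
    also have "\<dots> = integral {0..t} (\<lambda>t. \<beta> t \<theta>) ^ 0 / fact 0 * exp (- integral {0..t} (\<lambda>t. \<beta> t \<theta>))"
      using pc[of \<theta>] t unfolding poisson_counter_def by blast
    finally show ?thesis by simp
  qed
  have eq: "{\<omega>\<in>space M. \<forall>\<theta>. Q \<theta> t \<omega> = 0} = (\<Inter>\<theta>\<in>UNIV. Q \<theta> t -` {0} \<inter> space M)"
    by auto
  show "{\<omega>\<in>space M. \<forall>\<theta>. Q \<theta> t \<omega> = 0} \<in> sets M"
    by measurable
  have "indep_vars (\<lambda>_. PiM {0..} (\<lambda>_. count_space UNIV)) (\<lambda>\<theta> \<omega>. \<lambda>t\<in>{0..}. Q \<theta> t \<omega>) UNIV"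
    using Q by (simp add: independent_counters_def)
  then have "indep_vars (\<lambda>_. count_space UNIV) (\<lambda>\<theta> \<omega>. (\<lambda>t\<in>{0..}. Q \<theta> t \<omega>) t) UNIV"
    by (rule indep_vars_compose2[where Y="\<lambda>_ f. f t"]) (use t in auto)
  then have "indep_vars (\<lambda>_. count_space UNIV) (\<lambda>\<theta>. Q \<theta> t) UNIV"
    using t by simp
  then have "prob {\<omega>\<in>space M. \<forall>\<theta>. Q \<theta> t \<omega> = 0} = (\<Prod>\<theta>\<in>UNIV. prob (Q \<theta> t -` {0} \<inter> space M))"
    unfolding eq by (rule indep_varsD_finite) auto
  also have "\<dots> = (\<Prod>\<theta>\<in>UNIV. exp (- integral {0..t} (\<lambda>t. \<beta> t \<theta>)))"
    using single by (simp add: vimage_def Int_def conj_commute)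
  also have "\<dots> = exp (- integral {0..t} (\<lambda>u. \<Sum>\<theta>\<in>UNIV. \<beta> u \<theta>))"
    by (simp add: exp_sum[symmetric] sum_negf integral_sum int)
  finally show "prob {\<omega>\<in>space M. \<forall>\<theta>. Q \<theta> t \<omega> = 0} = exp (- integral {0..t} (\<lambda>u. \<Sum>\<theta>\<in>UNIV. \<beta> u \<theta>))" .
qed

text \<open>Counters are integer-valued and right-continuous, so if none has arrived by
  \<open>t\<close>, none arrives for a while after, which yields the strict inequality. Otherwise
  the supremum of the arrival-free times is a first arrival at or before \<open>t\<close>, and the
  process sits at a vertex there.\<close>

lemma stop_time_gt_iff:
  fixes Q :: "'n::finite \<Rightarrow> real \<Rightarrow> 'w \<Rightarrow> nat"
  assumes start: "\<And>\<theta>. Q \<theta> 0 \<omega> = 0" 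
    and mono: "\<And>\<theta> s t. 0 \<le> s \<Longrightarrow> s \<le> t \<Longrightarrow> Q \<theta> s \<omega> \<le> Q \<theta> t \<omega>"
    and rc: "\<And>\<theta> t. 0 \<le> t \<Longrightarrow> ((\<lambda>u. Q \<theta> u \<omega>) \<longlongrightarrow> Q \<theta> t \<omega>) (at_right t)"
    and before: "\<And>t. 0 \<le> t \<Longrightarrow> (\<forall>\<theta>. Q \<theta> t \<omega> = 0) \<Longrightarrow> X t \<omega> = muhat t"
    and after: "\<And>\<theta> s t. first_arrival Q \<omega> \<theta> s \<Longrightarrow> s \<le> t \<Longrightarrow> X t \<omega> = vertex \<theta>"
    and nv: "\<And>t. 0 \<le> t \<Longrightarrow> muhat t \<notin> range vertex"
    and t: "0 \<le> t"
  shows "ereal t < stop_time X \<omega> \<longleftrightarrow> (\<forall>\<theta>. Q \<theta> t \<omega> = 0)"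
proof
  have ev0: "\<exists>b>c. \<forall>u. c < u \<and> u < b \<longrightarrow> (\<forall>\<theta>. Q \<theta> u \<omega> = 0)" if "0 \<le> c" "\<And>\<theta>. Q \<theta> c \<omega> = 0" for c
  proof -
    have "eventually (\<lambda>u. \<forall>\<theta>. Q \<theta> u \<omega> = 0) (at_right c)"
      using rc[OF that(1)] that(2) by (intro eventually_all_finite) (simp add: tendsto_discrete)
    then show ?thesis by (auto simp: eventually_at_right_field)
  qed
  {
    assume none: "\<forall>\<theta>. Q \<theta> t \<omega> = 0"
    obtain b where b: "t < b" "\<And>u. t < u \<Longrightarrow> u < b \<Longrightarrow> \<forall>\<theta>. Q \<theta> u \<omega> = 0"
      using ev0[OF t] none by blast
    have zero: "\<forall>\<theta>. Q \<theta> u \<omega> = 0" if "0 \<le> u" "u < b" for u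
    proof (cases "u \<le> t")
      case True then show ?thesis using mono[OF that(1) True] none by (metis le_zero_eq)
    qed (use b that in auto)
    have "ereal b \<le> stop_time X \<omega>"
      unfolding stop_time_def
    proof (rule Inf_greatest)
      fix y assume "y \<in> ereal ` {t. 0 \<le> t \<and> X t \<omega> \<in> range vertex}"
      then obtain u where u: "y = ereal u" "0 \<le> u" "X u \<omega> \<in> range vertex" by auto
      have "\<not> u < b"
        using before[OF u(2) zero[OF u(2)]] nv[OF u(2)] u(3) by metis
      then show "ereal b \<le> y" using u by simp
    qed
    then show "ereal t < stop_time X \<omega>"
      using b(1) less_le_trans[of "ereal t" "ereal b"] by simp
  }
  {
    assume lt: "ereal t < stop_time X \<omega>"
    show "\<forall>\<theta>. Q \<theta> t \<omega> = 0"
    proof (rule ccontr)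
      assume "\<not> ?thesis"
      then obtain \<theta>0 where \<theta>0: "0 < Q \<theta>0 t \<omega>" by auto
      define Z where "Z = {u. 0 \<le> u \<and> (\<forall>\<theta>. Q \<theta> u \<omega> = 0)}"
      define c where "c = Sup Z"
      have Zt: "u \<le> t" if "u \<in> Z" for u
        using that mono[OF t, of u \<theta>0] \<theta>0 by (force simp: Z_def)
      have Z0: "0 \<in> Z" using start by (simp add: Z_def)
      have bdd: "bdd_above Z" using Zt by (auto simp: bdd_above_def)
      have c0: "0 \<le> c" "c \<le> t"
        unfolding c_def using Z0 bdd Zt by (auto intro: cSup_upper cSup_least)
      \<comment> \<open>The supremum \<open>c\<close> itself is not arrival-free: by
        right-continuity a point beyond \<open>c\<close> would then belong to
        \<open>Z\<close>.\<close>
      have "\<exists>\<theta>. 0 < Q \<theta> c \<omega>"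
      proof (rule ccontr)
        assume "\<not> ?thesis"
        then obtain b where b: "c < b" "\<And>u. c < u \<Longrightarrow> u < b \<Longrightarrow> \<forall>\<theta>. Q \<theta> u \<omega> = 0"
          using ev0[OF c0(1)] by auto
        then have "(c + b) / 2 \<in> Z" using c0 by (auto simp: Z_def)
        then have "(c + b) / 2 \<le> c" unfolding c_def using bdd by (rule cSup_upper)
        then show False using b(1) by simp
      qed
      then obtain \<theta> where \<theta>: "0 < Q \<theta> c \<omega>" by blast
      have "first_arrival Q \<omega> \<theta> c"
        unfolding first_arrival_def
      proof (intro conjI allI impI)
        fix u \<theta>' assume u: "0 \<le> u \<and> u < c"
        then obtain z where "z \<in> Z" "u < z"
          using less_cSup_iff[of Z u] Z0 bdd c_def by auto
        then show "Q \<theta>' u \<omega> = 0"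
          using mono[of u z \<theta>'] u by (simp add: Z_def)
      qed (use c0 \<theta> in auto)
      then have "X c \<omega> = vertex \<theta>" using after by blast
      then have "stop_time X \<omega> \<le> ereal c"
        unfolding stop_time_def using c0 by (intro Inf_lower) auto
      then show False using lt c0(2) by (metis ereal_less_eq(3) leD order_trans)
    qed
  }
qed

lemma survival_probability:
  fixes Q :: "'n::finite \<Rightarrow> real \<Rightarrow> 'w \<Rightarrow> nat"
  assumes M: "prob_space M" and Q: "independent_counters M \<beta> Q" and X: "greedy_process M Q muhat X"
    and tau: "stop_time X \<in> borel_measurable M"
    and nv: "\<And>t. 0 \<le> t \<Longrightarrow> muhat t \<notin> range vertex" and t: "0 \<le> t"
  shows "measure M {\<omega>\<in>space M. ereal t < stop_time X \<omega>} = exp (- integral {0..t} (\<lambda>u. \<Sum>\<theta>\<in>UNIV. \<beta> u \<theta>))"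
proof -
  interpret prob_space M by fact
  have "AE \<omega> in M. \<forall>\<theta>\<in>UNIV. Q \<theta> 0 \<omega> = 0 \<and> (\<forall>s t. 0 \<le> s \<and> s \<le> t \<longrightarrow> Q \<theta> s \<omega> \<le> Q \<theta> t \<omega>) \<and>
        (\<forall>t\<ge>0. ((\<lambda>u. Q \<theta> u \<omega>) \<longlongrightarrow> Q \<theta> t \<omega>) (at_right t))"
    using Q by (intro AE_finite_allI) (auto simp: independent_counters_def poisson_counter_def)
  then have "AE \<omega> in M. ereal t < stop_time X \<omega> \<longleftrightarrow> (\<forall>\<theta>. Q \<theta> t \<omega> = 0)"
    using X unfolding greedy_process_def
  proof eventually_elim
    case (elim \<omega>)
    show ?case
      by (rule stop_time_gt_iff[OF _ _ _ _ _ nv t]) (use elim in \<open>auto simp: first_arrival_def\<close>)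
  qed
  then have "measure M {\<omega>\<in>space M. ereal t < stop_time X \<omega>} = measure M {\<omega>\<in>space M. \<forall>\<theta>. Q \<theta> t \<omega> = 0}"
    using independent_counters_no_arrival(1)[OF M Q t] tau
    by (intro measure_eq_AE) (auto elim: AE_mp)
  then show ?thesis
    using independent_counters_no_arrival(2)[OF M Q t] by simp
qed

text \<open>From a vertex the process stops at time \<open>0\<close>, which would be an atom.\<close>

lemma initial_belief_not_vertex:
  fixes Q :: "'n::finite \<Rightarrow> real \<Rightarrow> 'w \<Rightarrow> nat"
  assumes M: "prob_space M" and Q: "independent_counters M \<beta> Q" and X: "greedy_process M Q muhat X"
    and f: "stopping_density M X f"
  shows "muhat 0 \<notin> range vertex"
proof
  assume v: "muhat 0 \<in> range vertex"
  interpret prob_space M by fact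
  have "AE \<omega> in M. \<forall>\<theta>\<in>UNIV. Q \<theta> 0 \<omega> = 0 \<and> (\<forall>s t. 0 \<le> s \<and> s \<le> t \<longrightarrow> Q \<theta> s \<omega> \<le> Q \<theta> t \<omega>) \<and>
        (\<forall>t\<ge>0. ((\<lambda>u. Q \<theta> u \<omega>) \<longlongrightarrow> Q \<theta> t \<omega>) (at_right t))"
    using Q by (intro AE_finite_allI) (auto simp: independent_counters_def poisson_counter_def)
  then have z: "AE \<omega> in M. real_of_ereal (stop_time X \<omega>) = 0"
    using X unfolding greedy_process_def
  proof eventually_elim
    case (elim \<omega>)
    then have "X 0 \<omega> \<in> range vertex" using v by auto
    then have "stop_time X \<omega> \<le> ereal 0"
      unfolding stop_time_def by (intro Inf_lower) auto
    moreover have "ereal 0 \<le> stop_time X \<omega>"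
      unfolding stop_time_def by (intro Inf_greatest) auto
    ultimately have "stop_time X \<omega> = ereal 0" by (rule order_antisym)
    then show ?case by simp
  qed
  have d: "distributed M lborel (\<lambda>\<omega>. real_of_ereal (stop_time X \<omega>)) (\<lambda>t. ennreal (f t))"
    using f by (simp add: stopping_density_def)
  have "emeasure M ((\<lambda>\<omega>. real_of_ereal (stop_time X \<omega>)) -` {0} \<inter> space M) = (\<integral>\<^sup>+x. ennreal (f x) * indicator {0} x \<partial>lborel)"
    using distributed_emeasure[OF d, of "{0}"] by simp
  also have "\<dots> = 0"
    using AE_lborel_singleton[of "0::real"] by (subst nn_integral_0_iff_AE) 
      (use d in \<open>auto simp: distributed_def elim!: AE_mp\<close>)
  finally have "AE \<omega> in M. real_of_ereal (stop_time X \<omega>) \<noteq> 0"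
    using distributed_measurable[OF d] by (subst AE_iff_measurable[OF _ refl]) (auto simp: vimage_def Int_def conj_commute)
  with z have "AE \<omega> in M. False" by eventually_elim simp
  then show False by (simp add: AE_False)
qed

text \<open>The law gives \<open>{0<..b}\<close> the mass
  \<open>1 - exp (- integral {0..b} B)\<close>, which is therefore the integral of \<open>f\<close>.
  As \<open>f\<close> and \<open>B\<close> are continuous, both expressions can be differentiated at
  every point, so the identity is not merely almost everywhere.\<close>

lemma density_from_survival:
  assumes M: "prob_space M" and f: "stopping_density M X f"
    and B: "continuous_on {0..} B"
    and S: "\<And>t. 0 \<le> t \<Longrightarrow> measure M {\<omega>\<in>space M. ereal t < stop_time X \<omega>} = exp (- integral {0..t} B)"
    and t: "0 \<le> t"
  shows "f t = B t * exp (- integral {0..t} B)"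
proof -
  interpret prob_space M by fact
  have tau [measurable]: "stop_time X \<in> borel_measurable M" and f0: "\<And>t. 0 \<le> f t"
    and fc: "continuous_on {0..} f"
    and d: "distributed M lborel (\<lambda>\<omega>. real_of_ereal (stop_time X \<omega>)) (\<lambda>t. ennreal (f t))"
    using f by (auto simp: stopping_density_def)
  define s where "s = (\<lambda>t. exp (- integral {0..t} B))"
  have int: "integral {0..b} f = 1 - s b" if b: "0 \<le> b" for b
  proof -
    have fb: "continuous_on {0..b} f" using fc by (rule continuous_on_subset) auto
    have eq: "(\<lambda>\<omega>. real_of_ereal (stop_time X \<omega>)) -` {0<..b} \<inter> space M
        = {\<omega>\<in>space M. ereal 0 < stop_time X \<omega>} - {\<omega>\<in>space M. ereal b < stop_time X \<omega>}"
      (is "?L = ?R")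
    proof -
      \<comment> \<open>\<open>real_of_ereal \<infinity> = 0\<close>, so never stopping is excluded on the left as well\<close>
      have "0 < real_of_ereal x \<and> real_of_ereal x \<le> b \<longleftrightarrow> ereal 0 < x \<and> \<not> ereal b < x" for x
        using b by (cases x) auto
      then show ?thesis unfolding vimage_def greaterThanAtMost_iff by blast
    qed
    have R: "prob ?R = s 0 - s b"
    proof -
      have "prob ?R = prob {\<omega>\<in>space M. ereal 0 < stop_time X \<omega>} - prob {\<omega>\<in>space M. ereal b < stop_time X \<omega>}"
      proof (rule finite_measure_Diff)
        show "{\<omega>\<in>space M. ereal b < stop_time X \<omega>} \<subseteq> {\<omega>\<in>space M. ereal 0 < stop_time X \<omega>}"
          using b le_less_trans[of "ereal 0" "ereal b"] by auto
      qed measurable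
      then show ?thesis using S[of 0] S[of b] b by (simp add: s_def)
    qed
    have "emeasure M ?L = ennreal (integral {0..b} f)"
    proof -
      have "emeasure M ?L = (\<integral>\<^sup>+x. ennreal (f x) * indicator {0<..b} x \<partial>lborel)"
        using distributed_emeasure[OF d, of "{0<..b}"] by simp
      also have "\<dots> = (\<integral>\<^sup>+x. ennreal (f x) * indicator {0..b} x \<partial>lborel)"
        using AE_lborel_singleton[of "0::real"]
        by (intro nn_integral_cong_AE) (auto elim!: AE_mp split: split_indicator)
      also have "\<dots> = ennreal (integral {0..b} f)"
        using fb f0 by (intro nn_integral_has_integral_lebesgue' integrable_integral integrable_continuous_real)
          auto
      finally show ?thesis .
    qed
    then have "ennreal (s 0 - s b) = ennreal (integral {0..b} f)"
      unfolding eq emeasure_eq_measure R .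
    moreover have "0 \<le> s 0 - s b"
      using measure_nonneg[of M ?R] R by simp
    ultimately have "integral {0..b} f = s 0 - s b"
      using f0 by (subst (asm) ennreal_inj) (auto intro!: integral_nonneg integrable_continuous_real fb)
    then show ?thesis by (simp add: s_def)
  qed
  \<comment> \<open>Any bound beyond \<open>t\<close> would do; at \<open>t = 0\<close> the
    derivative within \<open>{0..b}\<close> is one-sided but still unique.\<close>
  define b where "b = t + 1"
  have tb: "t \<in> {0..b}" using t by (simp add: b_def)
  have "((\<lambda>x. integral {0..x} f) has_real_derivative f t) (at t within {0..b})"
    using fc tb by (intro integral_has_real_derivative) (auto elim: continuous_on_subset)
  then have "((\<lambda>x. 1 - s x) has_real_derivative f t) (at t within {0..b})"
    using int by (rule has_field_derivative_transform_within[OF _ zero_less_one tb]) auto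
  moreover have "((\<lambda>x. integral {0..x} B) has_real_derivative B t) (at t within {0..b})"
    using B tb by (intro integral_has_real_derivative) (auto elim: continuous_on_subset)
  then have "((\<lambda>x. 1 - s x) has_real_derivative B t * s t) (at t within {0..b})"
    unfolding s_def by (auto intro!: derivative_eq_intros)
  ultimately have "f t = B t * s t"
    by (rule has_field_derivative_unique) (use t in \<open>simp add: b_def trivial_limit_within\<close>)
  then show ?thesis by (simp add: s_def)
qed

section \<open>The transfer price\<close>

lemma exp_diff_Lipschitz:
  fixes r s t :: real
  assumes "0 \<le> r" "0 \<le> s" "0 \<le> t"
  shows "\<bar>exp (- (r * t)) - exp (- (s * t))\<bar> \<le> \<bar>r - s\<bar> * t"
proof -
  have *: "exp (- (s * t)) - exp (- (r * t)) \<le> (r - s) * t" if "s \<le> r" "0 \<le> s" for r s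
  proof -
    have "exp (- (s * t)) - exp (- (r * t)) = exp (- (s * t)) * (1 - exp (- ((r - s) * t)))"
      by (simp add: algebra_simps flip: exp_add)
    also have "\<dots> \<le> 1 * ((r - s) * t)"
      using that assms exp_ge_add_one_self[of "- ((r - s) * t)"] by (intro mult_mono) auto
    finally show ?thesis by simp
  qed
  have le: "exp (- (r * t)) \<le> exp (- (s * t))" if "s \<le> r" for r s
    using that assms by (simp add: mult_right_mono)
  show ?thesis
    using *[of s r] *[of r s] le[of s r] le[of r s] assms by (cases "s \<le> r") auto
qed

text \<open>Taylor's formula in the discount rate. Pulling out the larger of the two exponentials,
  which is at most \<open>1\<close>, leaves a factor between \<open>0\<close> and
  \<open>d\<^sup>2\<close>, whichever of \<open>r\<close> and \<open>s\<close> is larger.\<close>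

lemma exp_diff_remainder:
  fixes r s t :: real
  assumes "0 \<le> r" "0 \<le> s" "0 \<le> t"
  shows "\<bar>exp (- (r * t)) - exp (- (s * t)) + (r - s) * (exp (- (s * t)) * t)\<bar> \<le> ((r - s) * t)\<^sup>2"
proof (cases "s \<le> r")
  case True
  define d where "d = (r - s) * t"
  have d: "0 \<le> d" using True assms by (simp add: d_def)
  have "exp (- d) \<le> 1 / (1 + d)"
    using exp_ge_add_one_self[of d] d by (simp add: exp_minus field_simps)
  also have "\<dots> \<le> 1 - d + d\<^sup>2"
    using d by (simp add: divide_le_eq) (simp add: power2_eq_square algebra_simps)
  finally have up: "exp (- d) - 1 + d \<le> d\<^sup>2" by simp
  have lo: "0 \<le> exp (- d) - 1 + d" using exp_ge_add_one_self[of "- d"] by simp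
  have "exp (- (r * t)) - exp (- (s * t)) + (r - s) * (exp (- (s * t)) * t) = exp (- (s * t)) * (exp (- d) - 1 + d)"
    by (simp add: d_def algebra_simps flip: exp_add)
  moreover have "exp (- (s * t)) * (exp (- d) - 1 + d) \<le> 1 * d\<^sup>2"
    using assms up lo by (intro mult_mono) auto
  moreover have "0 \<le> exp (- (s * t)) * (exp (- d) - 1 + d)" using lo by simp
  ultimately show ?thesis by (simp add: d_def)
next
  case False
  define d where "d = (s - r) * t"
  have d: "0 \<le> d" using False assms by (simp add: d_def)
  have "(1 - d) * (1 + d) \<le> exp (- d) * (1 + d)"
    using exp_ge_add_one_self[of "- d"] d by (intro mult_right_mono) auto
  then have up: "1 - exp (- d) * (1 + d) \<le> d\<^sup>2" by (simp add: power2_eq_square algebra_simps)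
  have lo: "0 \<le> 1 - exp (- d) * (1 + d)"
    using exp_ge_add_one_self[of d] d by (simp add: exp_minus field_simps)
  have "exp (- (r * t)) - exp (- (s * t)) + (r - s) * (exp (- (s * t)) * t) = exp (- (r * t)) * (1 - exp (- d) * (1 + d))"
    by (simp add: d_def algebra_simps flip: exp_add)
  moreover have "exp (- (r * t)) * (1 - exp (- d) * (1 + d)) \<le> 1 * d\<^sup>2"
    using assms up lo by (intro mult_mono) auto
  moreover have "0 \<le> exp (- (r * t)) * (1 - exp (- d) * (1 + d))" using lo by simp
  moreover have "d\<^sup>2 = ((r - s) * t)\<^sup>2" by (simp add: d_def power2_eq_square algebra_simps)
  ultimately show ?thesis by simp
qed

lemma indefinite_integral_derivative_atLeast:
  fixes \<phi> :: "real \<Rightarrow> real"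
  assumes "continuous_on {a..} \<phi>" "a \<le> x"
  shows "((\<lambda>x. integral {a..x} \<phi>) has_real_derivative \<phi> x) (at x within {a..})"
proof -
  have "((\<lambda>x. integral {a..x} \<phi>) has_real_derivative \<phi> x) (at x within {a..x + 1})"
    using assms by (intro integral_has_real_derivative continuous_on_subset[OF assms(1)]) auto
  also have "at x within {a..x + 1} = at x within {a..}"
    by (rule at_within_nhd[of x "{..<x + 1}"]) auto
  finally show ?thesis .
qed

text \<open>A crude bound, the largest value of the quadratic times the length. Its continuity in
  \<open>x\<close> is what controls the error terms when the cap moves with the type.\<close>

lemma integral_norm_le_power:
  fixes \<phi> :: "real \<Rightarrow> real"
  assumes "continuous_on {0..x} \<phi>" "0 \<le> x" and b: "\<And>t. 0 \<le> t \<Longrightarrow> t \<le> x \<Longrightarrow> \<bar>\<phi> t\<bar> \<le> c * t\<^sup>2" and "0 \<le> c"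
  shows "\<bar>integral {0..x} \<phi>\<bar> \<le> c * x ^ 3"
proof -
  have "norm (integral {0..x} \<phi>) \<le> integral {0..x} (\<lambda>t. c * x\<^sup>2)"
  proof (rule integral_norm_bound_integral)
    fix t assume t: "t \<in> {0..x}"
    then have "\<bar>\<phi> t\<bar> \<le> c * t\<^sup>2" using b by simp
    also have "\<dots> \<le> c * x\<^sup>2" using t assms by (intro mult_left_mono power_mono) auto
    finally show "norm (\<phi> t) \<le> c * x\<^sup>2" by simp
  qed (auto intro!: integrable_continuous_real assms continuous_intros)
  then show ?thesis using assms by (simp add: power2_eq_square power3_eq_cube mult_ac)
qed

section \<open>The derivative of the transfer in the type\<close>

context
  fixes f T :: "real \<Rightarrow> real" and rl rh C :: real
  assumes f: "continuous_on {0..} f" "\<And>t. 0 \<le> f t" "\<And>t. 0 \<le> t \<Longrightarrow> f t \<le> C"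
    and rl: "0 < rl"
    and T: "antimono_on {rl<..rh} T" "\<And>r. r \<in> {rl<..rh} \<Longrightarrow> 0 \<le> T r"
begin

definition discounted :: "real \<Rightarrow> real \<Rightarrow> real" where
  "discounted r x = integral {0..x} (\<lambda>t. exp (- (r * t)) * f t)"

text \<open>Minus the derivative of \<open>discounted r x\<close> in \<open>r\<close>.\<close>

definition discounted_mean :: "real \<Rightarrow> real \<Rightarrow> real" where
  "discounted_mean r x = integral {0..x} (\<lambda>t. exp (- (r * t)) * t * f t)"

lemma f_continuous: "continuous_on {0..x} f"
  by (rule continuous_on_subset[OF f(1)]) auto

lemma continuous_integrands:
  "continuous_on {0..x} (\<lambda>t. exp (- (r * t)) * f t)"
  "continuous_on {0..x} (\<lambda>t. exp (- (r * t)) * t * f t)"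
  by (intro continuous_intros f_continuous)+

lemmas integrable_integrands = continuous_integrands[THEN integrable_continuous_real]

lemma C_nonneg: "0 \<le> C"
  using f(2,3)[of 0] by simp

lemma discounted_mean_Lipschitz:
  assumes "0 \<le> r" "0 \<le> s" "0 \<le> x"
  shows "\<bar>discounted_mean r x - discounted_mean s x\<bar> \<le> \<bar>r - s\<bar> * C * x ^ 3"
proof -
  have "\<bar>integral {0..x} (\<lambda>t. (exp (- (r * t)) - exp (- (s * t))) * t * f t)\<bar> \<le> (\<bar>r - s\<bar> * C) * x ^ 3"
  proof (rule integral_norm_le_power)
    fix t :: real assume t: "0 \<le> t" "t \<le> x"
    have "\<bar>(exp (- (r * t)) - exp (- (s * t))) * t * f t\<bar> = \<bar>exp (- (r * t)) - exp (- (s * t))\<bar> * t * f t"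
      using t f(2) by (simp add: abs_mult)
    also have "\<dots> \<le> (\<bar>r - s\<bar> * t) * t * C"
      using t assms f(2,3) by (intro mult_mono exp_diff_Lipschitz) auto
    finally show "\<bar>(exp (- (r * t)) - exp (- (s * t))) * t * f t\<bar> \<le> \<bar>r - s\<bar> * C * t\<^sup>2"
      by (simp add: power2_eq_square mult_ac)
  qed (use assms C_nonneg in \<open>auto intro!: continuous_intros f_continuous\<close>)
  moreover have "discounted_mean r x - discounted_mean s x =
      integral {0..x} (\<lambda>t. (exp (- (r * t)) - exp (- (s * t))) * t * f t)"
    unfolding discounted_mean_def
    by (subst integral_diff[OF integrable_integrands(2) integrable_integrands(2), symmetric])
       (simp add: algebra_simps)
  ultimately show ?thesis by simp
qed

lemma discounted_remainder:
  assumes "0 \<le> r" "0 \<le> s" "0 \<le> x"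
  shows "\<bar>discounted r x - discounted s x + (r - s) * discounted_mean s x\<bar> \<le> (r - s)\<^sup>2 * C * x ^ 3"
proof -
  let ?e = "\<lambda>t. exp (- (r * t)) - exp (- (s * t)) + (r - s) * (exp (- (s * t)) * t)"
  have "\<bar>integral {0..x} (\<lambda>t. ?e t * f t)\<bar> \<le> ((r - s)\<^sup>2 * C) * x ^ 3"
  proof (rule integral_norm_le_power)
    fix t :: real assume t: "0 \<le> t" "t \<le> x"
    have "\<bar>?e t * f t\<bar> = \<bar>?e t\<bar> * f t"
      using f(2) by (simp add: abs_mult)
    also have "\<dots> \<le> ((r - s) * t)\<^sup>2 * C"
      using t assms f(2,3) by (intro mult_mono exp_diff_remainder) auto
    finally show "\<bar>?e t * f t\<bar> \<le> (r - s)\<^sup>2 * C * t\<^sup>2"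
      by (simp add: power_mult_distrib mult_ac)
  qed (use assms C_nonneg in \<open>auto intro!: continuous_intros f_continuous\<close>)
  moreover have "((\<lambda>t. exp (- (r * t)) * f t - exp (- (s * t)) * f t + (r - s) * (exp (- (s * t)) * t * f t))
      has_integral (discounted r x - discounted s x + (r - s) * discounted_mean s x)) {0..x}"
    unfolding discounted_def discounted_mean_def
    by (intro has_integral_add has_integral_diff has_integral_mult_right integrable_integral integrable_integrands)
  then have "discounted r x - discounted s x + (r - s) * discounted_mean s x = integral {0..x} (\<lambda>t. ?e t * f t)"
    by (subst (asm) has_integral_cong[of _ _ "\<lambda>t. ?e t * f t"]) (auto simp: algebra_simps integral_unique)
  ultimately show ?thesis by simp
qed

lemma discounted_mean_nonneg: "0 \<le> x \<Longrightarrow> 0 \<le> discounted_mean r x"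
  unfolding discounted_mean_def using f(2) by (intro integral_nonneg integrable_integrands) auto

text \<open>A larger type both shortens the interval of integration and lowers the discount
  factor.\<close>

lemma discounted_mean_T_antimono:
  assumes "z \<in> {rl<..rh}" "z' \<in> {rl<..rh}" "z \<le> z'"
  shows "discounted_mean z' (T z') \<le> discounted_mean z (T z)"
proof -
  have "T z' \<le> T z" using T(1) assms by (auto simp: monotone_on_def)
  moreover have "0 \<le> T z'" using T(2) assms by simp
  ultimately have "discounted_mean z' (T z') \<le> discounted_mean z' (T z)"
    unfolding discounted_mean_def using f(2) by (intro integral_subset_le integrable_integrands) auto
  also have "\<dots> \<le> discounted_mean z (T z)"
    unfolding discounted_mean_def using f(2) assms
    by (intro integral_le integrable_integrands) (auto intro!: mult_right_mono)
  finally show ?thesis .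
qed

text \<open>Monotonicity gives measurability, and the value at the left end \<open>r\<close> bounds
  the integrand.\<close>

lemma set_integrable_discounted_mean_T:
  assumes r: "r \<in> {rl<..rh}"
  shows "set_integrable lborel {r..rh} (\<lambda>z. discounted_mean z (T z))"
  unfolding set_integrable_def
proof (rule Bochner_Integration.integrable_bound)
  have "mono_on {r..rh} (\<lambda>z. - discounted_mean z (T z))"
    using r by (intro mono_onI) (auto intro!: discounted_mean_T_antimono)
  then have "(\<lambda>z. - discounted_mean z (T z)) \<in> borel_measurable (restrict_space borel {r..rh})"
    by (rule borel_measurable_mono_on_fnc)
  then have "(\<lambda>z. - (- discounted_mean z (T z))) \<in> borel_measurable (restrict_space borel {r..rh})"
    by (rule borel_measurable_uminus)
  then show "(\<lambda>z. indicator {r..rh} z *\<^sub>R discounted_mean z (T z)) \<in> borel_measurable lborel"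
    by (simp add: borel_measurable_restrict_space_iff)
  show "integrable lborel (\<lambda>z. indicator {r..rh} z *\<^sub>R discounted_mean r (T r))"
    by (intro integrable_scaleR_left integrable_real_indicator) (auto simp: emeasure_lborel_Icc_eq)
  show "AE z in lborel. norm (indicator {r..rh} z *\<^sub>R discounted_mean z (T z)) \<le>
      norm (indicator {r..rh} z *\<^sub>R discounted_mean r (T r))"
    using r discounted_mean_T_antimono[of r] discounted_mean_nonneg T(2)
    by (intro always_eventually) (auto simp: indicator_def)
qed

text \<open>The outer integral runs over \<open>z \<ge> r > rl\<close>, so an infinite cap at
  \<open>rl\<close> never enters and all integrals are over compact intervals.\<close>

lemma transfer_price_eq:
  assumes r: "r \<in> {rl<..rh}" and cap: "\<And>z. z \<in> {rl<..rh} \<Longrightarrow> cap z = ereal (T z)"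
  shows "transfer_price rh f cap r =
    discounted r (T r) - integral {r..rh} (\<lambda>z. discounted_mean z (T z))"
proof -
  have set: "{t. 0 \<le> t \<and> ereal t \<le> cap z} = {0..T z}" if "z \<in> {rl<..rh}" for z
    using cap[OF that] by auto
  have "(LINT t:{t. 0 \<le> t \<and> ereal t \<le> cap r}|lborel. exp (- (r * t)) * f t) = discounted r (T r)"
    unfolding set[OF r] discounted_def
    by (intro set_borel_integral_eq_integral borel_integrable_atLeastAtMost' continuous_integrands)
  moreover have "(LINT t:{t. 0 \<le> t \<and> ereal t \<le> cap z}|lborel. exp (- (z * t)) * t * f t) = discounted_mean z (T z)"
    if "z \<in> {rl<..rh}" for z
    unfolding set[OF that] discounted_mean_def
    by (intro set_borel_integral_eq_integral borel_integrable_atLeastAtMost' continuous_integrands)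
  then have "(LINT z:{r..rh}|lborel. (LINT t:{t. 0 \<le> t \<and> ereal t \<le> cap z}|lborel. exp (- (z * t)) * t * f t))
      = (LINT z:{r..rh}|lborel. discounted_mean z (T z))"
    using r by (intro set_lebesgue_integral_cong) auto
  moreover have "\<dots> = integral {r..rh} (\<lambda>z. discounted_mean z (T z))"
    by (intro set_borel_integral_eq_integral set_integrable_discounted_mean_T r)
  ultimately show ?thesis
    by (simp add: transfer_price_def)
qed

text \<open>Splitting \<open>discounted z (T z)\<close> into \<open>discounted r (T z)\<close> and a
  difference separates the effects of cap and discount rate. The former yields the term with
  \<open>T'\<close>. The difference and the outer integral, through its lower limit, both have
  derivative \<open>- discounted_mean r (T r)\<close>, and these cancel because the integral is
  subtracted. As \<open>T\<close> is assumed differentiable only at \<open>r\<close>, the outer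
  integrand is shown continuous only there.\<close>

lemma transfer_price_derivative:
  assumes r: "r \<in> {rl<..rh}" and cap: "\<And>z. z \<in> {rl<..rh} \<Longrightarrow> cap z = ereal (T z)"
    and T': "(T has_real_derivative T') (at r within {rl<..rh})"
  shows "(transfer_price rh f cap has_real_derivative exp (- (r * T r)) * f (T r) * T') (at r within {rl<..rh})"
proof -
  let ?S = "{rl<..rh}"
  let ?J = "discounted_mean r (T r)"
  have T_lim: "(T \<longlongrightarrow> T r) (at r within ?S)"
    using DERIV_continuous[OF T'] by (simp add: continuous_within)
  have T_img: "T ` ?S \<subseteq> {0..}" using T(2) by auto
  have der_mean: "(discounted_mean r has_real_derivative exp (- (r * x)) * x * f x) (at x within {0..})"
    and der_disc: "(discounted r has_real_derivative exp (- (r * x)) * f x) (at x within {0..})" if "0 \<le> x" for x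
    unfolding discounted_mean_def[abs_def] discounted_def[abs_def] using that f(1)
    by (auto intro!: indefinite_integral_derivative_atLeast continuous_intros)
  have "((\<lambda>z. discounted_mean r (T z)) has_real_derivative (exp (- (r * T r)) * T r * f (T r)) * T') (at r within ?S)"
    using DERIV_image_chain[OF has_field_derivative_subset[OF der_mean[OF T(2)[OF r]] T_img] T']
    by (simp add: o_def)
  then have mean_lim: "((\<lambda>z. discounted_mean r (T z)) \<longlongrightarrow> ?J) (at r within ?S)"
    using DERIV_continuous by (force simp: continuous_within)
  have err: "((\<lambda>z. \<bar>z - r\<bar> * C * T z ^ 3) \<longlongrightarrow> \<bar>r - r\<bar> * C * T r ^ 3) (at r within ?S)"
    by (intro tendsto_intros T_lim)
  have "((\<lambda>z. discounted_mean z (T z) - discounted_mean r (T z)) \<longlongrightarrow> 0) (at r within ?S)"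
  proof (rule Lim_null_comparison)
    show "eventually (\<lambda>z. norm (discounted_mean z (T z) - discounted_mean r (T z)) \<le> \<bar>z - r\<bar> * C * T z ^ 3) (at r within ?S)"
      using rl r T(2) discounted_mean_Lipschitz by (auto simp: eventually_at_filter)
    show "((\<lambda>z. \<bar>z - r\<bar> * C * T z ^ 3) \<longlongrightarrow> 0) (at r within ?S)"
      using err by simp
  qed
  from tendsto_add[OF this mean_lim]
  have I_lim: "((\<lambda>z. discounted_mean z (T z)) \<longlongrightarrow> ?J) (at r within ?S)"
    by simp
  have rest: "((\<lambda>z. discounted z (T z) - discounted r (T z)) has_real_derivative - ?J) (at r within ?S)"
    unfolding has_field_derivative_iff
  proof -
    \<comment> \<open>The quotient is compared with the moving
      \<open>discounted_mean r (T z)\<close>, to which the remainder estimate applies at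
      \<open>x = T z\<close>; this term in turn tends to \<open>?J\<close>.\<close>
    have "((\<lambda>z. (discounted z (T z) - discounted r (T z)) / (z - r) + discounted_mean r (T z)) \<longlongrightarrow> 0) (at r within ?S)"
    proof (rule Lim_null_comparison)
      have "norm ((discounted z (T z) - discounted r (T z)) / (z - r) + discounted_mean r (T z)) \<le> \<bar>z - r\<bar> * C * T z ^ 3"
        if z: "z \<in> ?S" "z \<noteq> r" for z
      proof -
        have "(discounted z (T z) - discounted r (T z)) / (z - r) + discounted_mean r (T z) =
            (discounted z (T z) - discounted r (T z) + (z - r) * discounted_mean r (T z)) / (z - r)"
          using z(2) by (simp add: field_simps)
        also have "norm \<dots> \<le> ((z - r)\<^sup>2 * C * T z ^ 3) / \<bar>z - r\<bar>"
          unfolding real_norm_def abs_divide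
          using z r rl T(2)[OF z(1)] by (intro divide_right_mono discounted_remainder) auto
        also have "\<dots> = \<bar>z - r\<bar> * C * T z ^ 3"
        proof -
          have sq: "(z - r)\<^sup>2 = \<bar>z - r\<bar> * \<bar>z - r\<bar>" by (simp add: power2_eq_square)
          show ?thesis unfolding sq using z(2) by (simp del: abs_mult_self_eq)
        qed
        finally show ?thesis .
      qed
      then show "eventually (\<lambda>z. norm ((discounted z (T z) - discounted r (T z)) / (z - r) + discounted_mean r (T z))
          \<le> \<bar>z - r\<bar> * C * T z ^ 3) (at r within ?S)"
        by (auto simp: eventually_at_filter)
      show "((\<lambda>z. \<bar>z - r\<bar> * C * T z ^ 3) \<longlongrightarrow> 0) (at r within ?S)"
        using err by simp
    qed
    from tendsto_diff[OF this mean_lim]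
    show "((\<lambda>z. (discounted z (T z) - discounted r (T z) - (discounted r (T r) - discounted r (T r))) / (z - r))
        \<longlongrightarrow> - ?J) (at r within ?S)"
      by simp
  qed
  have main: "((\<lambda>z. discounted r (T z)) has_real_derivative (exp (- (r * T r)) * f (T r)) * T') (at r within ?S)"
    using DERIV_image_chain[OF has_field_derivative_subset[OF der_disc[OF T(2)[OF r]] T_img] T']
    by (simp add: o_def)
  \<comment> \<open>\<open>T\<close> may be unbounded near \<open>rl\<close>, so the indefinite
    integral starts strictly between \<open>rl\<close> and \<open>r\<close>; \<open>{a..rh}\<close>
    is still a neighbourhood of \<open>r\<close> relative to \<open>?S\<close>.\<close>
  define a where "a = (rl + r) / 2"
  have a: "rl < a" "a < r" "a \<in> ?S" using r by (auto simp: a_def)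
  have at_eq: "at r within {a..rh} = at r within ?S"
    using a by (intro at_within_nhd[of r "{a<..}"]) auto
  let ?I = "\<lambda>z. discounted_mean z (T z)"
  have int: "?I integrable_on {a..rh}"
    using set_borel_integral_eq_integral(1)[OF set_integrable_discounted_mean_T[OF a(3)]] .
  have "((\<lambda>u. integral {a..u} ?I) has_vector_derivative ?J) (at r within ({a..rh} - {}))"
    using a r I_lim by (intro integral_has_vector_derivative_continuous_at int)
      (auto simp: continuous_within at_eq)
  then have "((\<lambda>u. integral {a..u} ?I) has_real_derivative ?J) (at r within {a..rh})"
    by (simp add: has_real_derivative_iff_has_vector_derivative)
  then have "((\<lambda>u. integral {a..rh} ?I - integral {a..u} ?I) has_real_derivative 0 - ?J) (at r within {a..rh})"
    by (intro DERIV_diff DERIV_const)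
  then have "((\<lambda>u. integral {u..rh} ?I) has_real_derivative 0 - ?J) (at r within {a..rh})"
  proof (rule has_field_derivative_transform_within[OF _ zero_less_one])
    show "r \<in> {a..rh}" using a r by simp
    fix u assume "u \<in> {a..rh}"
    then show "integral {a..rh} ?I - integral {a..u} ?I = integral {u..rh} ?I"
      using Henstock_Kurzweil_Integration.integral_combine[OF _ _ int, of u] by simp
  qed
  then have inner: "((\<lambda>u. integral {u..rh} ?I) has_real_derivative - ?J) (at r within ?S)"
    by (simp add: at_eq)
  have "((\<lambda>z. discounted r (T z) + (discounted z (T z) - discounted r (T z)) - integral {z..rh} ?I)
      has_real_derivative (exp (- (r * T r)) * f (T r)) * T' + - ?J - - ?J) (at r within ?S)"
    by (intro DERIV_diff DERIV_add main rest inner)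
  then have "((\<lambda>z. discounted z (T z) - integral {z..rh} ?I)
      has_real_derivative (exp (- (r * T r)) * f (T r)) * T') (at r within ?S)"
    by simp
  then show ?thesis
    by (rule has_field_derivative_transform_within[OF _ zero_less_one r])
       (rule transfer_price_eq[OF _ cap, symmetric])
qed

end

section \<open>Hazard, density and marginal price combined\<close>

lemma belief_simplex_open_face: "\<mu> \<in> belief_simplex \<Longrightarrow> \<mu> \<in> open_face {i. 0 < \<mu> $ i}"
  by (simp add: open_face_def)

theorem mainTheorem3:
  fixes H :: "real ^ 'n \<Rightarrow> real" and \<mu>0 :: "real ^ 'n"
    and chi rl rh :: real and G g :: "real \<Rightarrow> real"
    and start :: "nat \<Rightarrow> ereal" and A :: "nat \<Rightarrow> 'n set"
    and \<beta> :: "real \<Rightarrow> 'n \<Rightarrow> real" and muhat :: "real \<Rightarrow> real ^ 'n"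
    and M :: "'w measure" and Q :: "'n \<Rightarrow> real \<Rightarrow> 'w \<Rightarrow> nat" and X :: "real \<Rightarrow> 'w \<Rightarrow> real ^ 'n"
    and f T P :: "real \<Rightarrow> real" and cap :: "real \<Rightarrow> ereal"
  assumes "0 < chi" and "\<mu>0 \<in> belief_simplex"
    and "entropy_fun H" and "D_assumptions H"
    and "greedy_path H chi \<mu>0 start A \<beta> muhat"
    and "prob_space M" and "independent_counters M \<beta> Q" and "greedy_process M Q muhat X"
    and "stopping_density M X f"
    and "0 < rl" and "rl < rh" and "type_distribution rl rh G g"
    and "antimono_on {rl<..rh} (\<lambda>r. g r / G r)"
    and cap: "cap = time_cap rl G g"
    and T: "T = (\<lambda>r. real_of_ereal (cap r))"
    and P: "P = transfer_price rh f cap"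
  shows
    "(\<forall>r\<in>{rl<..rh}. \<forall>T'. (T has_real_derivative T') (at r within {rl<..rh}) \<and> T' \<noteq> 0 \<longrightarrow>
        marginal_price P T {rl<..rh} r (exp (- (r * T r)) * f (T r))) \<and>
     (antimono_on {0..} f \<and> antimono_on {rl<..rh} (\<lambda>r. r * T r) \<longrightarrow>
        (\<forall>r1\<in>{rl<..rh}. \<forall>r2\<in>{rl<..rh}. \<forall>m1 m2.
           marginal_price P T {rl<..rh} r1 m1 \<and> marginal_price P T {rl<..rh} r2 m2 \<and>
           chi * T r1 < chi * T r2 \<longrightarrow> m2 < m1) \<and>
        (\<forall>r1\<in>{rl<..rh}. \<forall>r2\<in>{rl<..rh}. chi * T r1 < chi * T r2 \<longrightarrow>
           exp (- (r2 * T r2)) * f (T r2) < exp (- (r1 * T r1)) * f (T r1))) \<and>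
     mono_on {0..} (zeta H muhat) \<and>
     (\<forall>t\<ge>0. hazard_rate M (stop_time X) f t = chi / zeta H muhat t) \<and>
     antimono_on {0..} (\<lambda>t. chi / zeta H muhat t) \<and>
     antimono_on {0..} f"
proof -
  have mu0: "muhat 0 = \<mu>0"
    by (rule assms(5)[unfolded greedy_path_def, THEN conjunct2, THEN conjunct1])
  have path: "greedy_path H chi (muhat 0) start A \<beta> muhat"
    unfolding mu0 by (rule assms(5))
  define F where "F = {i. 0 < \<mu>0 $ i}"
  have face: "\<mu>0 \<in> open_face F"
    unfolding F_def using assms(2) by (rule belief_simplex_open_face)
  have "F \<noteq> {}"
  proof
    assume "F = {}"
    then have "\<mu>0 $ i = 0" for i
      using assms(2) by (auto simp: F_def belief_simplex_def order.order_iff_strict)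
    then show False using assms(2) by (simp add: belief_simplex_def)
  qed
  then have "C2_on H (open_face F)" and conv: "strictly_convex_on belief_simplex H"
    using assms(3) by (auto simp: entropy_fun_def)
  then obtain gr hs where
    "\<forall>x\<in>open_face F. (H has_derivative (\<lambda>v. gr x \<bullet> v)) (at x within open_face F)"
    "\<forall>x\<in>open_face F. (gr has_derivative (\<lambda>v. hs x *v v)) (at x within open_face F)"
    by (auto simp: C2_on_def)
  moreover obtain eps where "0 < eps" "\<forall>\<mu>\<in>belief_simplex. \<forall>\<theta>. \<mu> $ \<theta> \<le> eps \<longrightarrow>
      Min ((\<lambda>\<theta>'. divergence H (vertex \<theta>') \<mu>) ` (UNIV - {\<theta>})) < divergence H (vertex \<theta>) \<mu>"
    using assms(4) by (auto simp: D_assumptions_def)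
  \<comment> \<open>Non-degeneracy of the prior follows from the stopping time having a
    density.\<close>
  moreover have "muhat 0 \<notin> range vertex"
    by (rule initial_belief_not_vertex[OF assms(6-9)])
  moreover have "(\<lambda>u. \<beta> u \<theta>) integrable_on {s..t}" if "0 \<le> s" "s \<le> t" for s t \<theta>
    using assms(7) that by (auto simp: independent_counters_def poisson_counter_def)
  ultimately interpret greedy_on_face H chi start A \<beta> muhat F gr hs eps
    using assms(1) conv path face mu0 by unfold_locales auto

  define S where "S = (\<lambda>t. exp (- integral {0..t} total_rate))"
  have f: "stop_time X \<in> borel_measurable M" "continuous_on {0..} f" "\<And>t. 0 \<le> f t"
    using assms(9) by (auto simp: stopping_density_def)
  have survival: "measure M {\<omega>\<in>space M. ereal t < stop_time X \<omega>} = S t" if "0 \<le> t" for t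
    unfolding S_def total_rate_def[abs_def]
    using on_face not_vertex by (intro survival_probability[OF assms(6-8) f(1) _ that]) blast
  have zpos: "0 < zeta H muhat t" if "0 \<le> t" for t
    using zeta_pos on_face that by blast
  have rate_pos: "0 < total_rate t" if "0 \<le> t" for t
    using hazard zpos chi that by simp
  have rate_antimono: "total_rate t \<le> total_rate s" if "0 \<le> s" "s \<le> t" for s t
    using zeta_mono zpos[of s] chi that hazard[of s] hazard[of t]
    by (auto simp: mono_on_def intro!: divide_left_mono mult_pos_pos zpos)
  have "continuous_on {0..} (\<lambda>t. chi / zeta H muhat t)"
    using continuous_zeta zpos by (intro continuous_intros) (auto simp: less_imp_neq[symmetric])
  then have rate_cont: "continuous_on {0..} total_rate"
    using hazard by (subst continuous_on_cong[OF refl]) auto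
  have f_eq: "f t = total_rate t * S t" if "0 \<le> t" for t
    unfolding S_def using survival that
    by (intro density_from_survival[OF assms(6,9) rate_cont]) (auto simp: S_def)
  have S_strict: "S t < S s" if "0 \<le> s" "s < t" for s t
  proof -
    have int: "total_rate integrable_on {a..b}" if "0 \<le> a" for a b
      using rate_cont that by (intro integrable_continuous_real continuous_on_subset[OF rate_cont]) auto
    have "0 < (t - s) * total_rate t" using that rate_pos by simp
    also have "\<dots> = integral {s..t} (\<lambda>_. total_rate t)" using that by simp
    also have "\<dots> \<le> integral {s..t} total_rate"
      using that by (intro integral_le int rate_antimono) auto
    finally have "integral {0..s} total_rate < integral {0..t} total_rate"
      using Henstock_Kurzweil_Integration.integral_combine[of 0 s t total_rate] that int by simp
    then show ?thesis by (simp add: S_def)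
  qed
  \<comment> \<open>The hazard is only weakly decreasing; strictness comes from the survival
    probability, since the hazard is positive.\<close>
  have f_strict: "f t < f s" if "0 \<le> s" "s < t" for s t
  proof -
    have "f t \<le> total_rate s * S t"
      using that rate_antimono[of s t] by (simp add: f_eq S_def)
    also have "\<dots> < total_rate s * S s"
      using that S_strict rate_pos by simp
    finally show ?thesis using that by (simp add: f_eq)
  qed
  have f_pos: "0 < f t" if "0 \<le> t" for t
    using that rate_pos by (simp add: f_eq S_def)
  have f_antimono: "antimono_on {0..} f"
    using f_strict by (auto simp: monotone_on_def order.order_iff_strict)

  have T_eq: "T r = g r / G r" and cap_eq: "cap r = ereal (T r)" if "r \<in> {rl<..rh}" for r
    using that by (auto simp: T cap time_cap_def)
  \<comment> \<open>Where \<open>G r = 0\<close>, division by zero makes the cap \<open>0\<close>,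
    so the bound holds on all of \<open>{rl<..rh}\<close>.\<close>
  have T_nonneg: "0 \<le> T r" if "r \<in> {rl<..rh}" for r
    using assms(12) that by (auto simp: T_eq type_distribution_def cdf_def)
  have T_antimono: "antimono_on {rl<..rh} T"
    using assms(13) T_eq by (simp add: monotone_on_def)
  have P': "(P has_real_derivative exp (- (r * T r)) * f (T r) * T') (at r within {rl<..rh})"
    if "r \<in> {rl<..rh}" "(T has_real_derivative T') (at r within {rl<..rh})" for r T'
    unfolding P
  proof (rule transfer_price_derivative[OF f(2,3) _ assms(10) T_antimono T_nonneg that(1) cap_eq that(2)])
    \<comment> \<open>By monotonicity the initial value of the density serves as its upper bound
      \<open>C\<close>.\<close>
    show "f t \<le> f 0" if "0 \<le> t" for t
      using f_antimono that by (simp add: monotone_on_def)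
  qed
  have price: "marginal_price P T {rl<..rh} r (exp (- (r * T r)) * f (T r))"
    if "r \<in> {rl<..rh}" "(T has_real_derivative T') (at r within {rl<..rh})" "T' \<noteq> 0" for r T'
    unfolding marginal_price_def
    using that by (intro exI[of _ "exp (- (r * T r)) * f (T r) * T'"] exI[of _ T'] conjI P') simp_all
  have price_unique: "m = exp (- (r * T r)) * f (T r)"
    if r: "r \<in> {rl<..rh}" and m: "marginal_price P T {rl<..rh} r m" for r m
  proof -
    obtain P1 T1 where "(P has_real_derivative P1) (at r within {rl<..rh})" 
      and T1: "(T has_real_derivative T1) (at r within {rl<..rh})" "T1 \<noteq> 0" "m = P1 / T1"
      using m by (auto simp: marginal_price_def)
    \<comment> \<open>Every \<open>r\<close> here is a limit point of the type interval, including
      the end point \<open>rh\<close>, so derivatives relative to it are unique.\<close>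
    moreover have "at r within {rl<..rh} \<noteq> bot"
      using r by (simp add: trivial_limit_within)
    ultimately have "P1 = exp (- (r * T r)) * f (T r) * T1"
      using P'[OF r T1(1)] has_field_derivative_unique by blast
    then show ?thesis using T1 by simp
  qed
  have decreasing: "exp (- (r2 * T r2)) * f (T r2) < exp (- (r1 * T r1)) * f (T r1)"
    if b: "antimono_on {rl<..rh} (\<lambda>r. r * T r)" and r: "r1 \<in> {rl<..rh}" "r2 \<in> {rl<..rh}"
      and lt: "chi * T r1 < chi * T r2" for r1 r2
  proof -
    have lt': "T r1 < T r2" using lt chi by simp
    \<comment> \<open>A larger cap belongs to a lower type, so the weak monotonicity of
      \<open>r * T r\<close> orders the discount factors; the strict inequality then comes from the
      density.\<close>
    have "r2 \<le> r1"
    proof (rule ccontr)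
      assume "\<not> r2 \<le> r1"
      then have "T r2 \<le> T r1" using T_antimono r by (simp add: monotone_on_def)
      then show False using lt' by simp
    qed
    then have "r1 * T r1 \<le> r2 * T r2" using b r by (auto simp: monotone_on_def)
    then have "exp (- (r2 * T r2)) * f (T r2) \<le> exp (- (r1 * T r1)) * f (T r2)"
      using f(3) by (intro mult_right_mono) auto
    also have "\<dots> < exp (- (r1 * T r1)) * f (T r1)"
      using f_strict[OF T_nonneg[OF r(1)] lt'] by simp
    finally show ?thesis .
  qed
  show ?thesis
  proof (intro conjI impI ballI allI; (elim conjE)?)
    show "marginal_price P T {rl<..rh} r (exp (- (r * T r)) * f (T r))"
      if "r \<in> {rl<..rh}" "(T has_real_derivative T') (at r within {rl<..rh})" "T' \<noteq> 0" for r T'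
      by (rule price[OF that])
    show "m2 < m1" if "antimono_on {rl<..rh} (\<lambda>r. r * T r)" "r1 \<in> {rl<..rh}" "r2 \<in> {rl<..rh}"
      "marginal_price P T {rl<..rh} r1 m1" "marginal_price P T {rl<..rh} r2 m2" "chi * T r1 < chi * T r2"
      for r1 r2 m1 m2
      using decreasing[OF that(1,2,3,6)] price_unique[OF that(2,4)] price_unique[OF that(3,5)] by simp
    show "exp (- (r2 * T r2)) * f (T r2) < exp (- (r1 * T r1)) * f (T r1)"
      if "antimono_on {rl<..rh} (\<lambda>r. r * T r)" "r1 \<in> {rl<..rh}" "r2 \<in> {rl<..rh}" "chi * T r1 < chi * T r2"
      for r1 r2
      by (rule decreasing[OF that])
    show "mono_on {0..} (zeta H muhat)" by (rule zeta_mono)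
    show "hazard_rate M (stop_time X) f t = chi / zeta H muhat t" if "0 \<le> t" for t
      using that survival f_eq hazard by (simp add: hazard_rate_def S_def)
    show "antimono_on {0..} (\<lambda>t. chi / zeta H muhat t)"
      using rate_antimono hazard by (auto simp: monotone_on_def)
    show "antimono_on {0..} f" by (rule f_antimono)
  qed
qed

end
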